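(* For every integer $d\ge 2$ such that $d\ne 3$ and every vertex $v$ of a $(d+1)$-cube $Q_{d+1}$, the link of $v$ in $Q_{d+1}$ is $\lfloor (d+1)/2\rfloor$-linked; that is, the graph of the link is $\lfloor (d+1)/2\rfloor$-linked.
   Context: A $(d+1)$-cube $Q_{d+1}$ is a polytope combinatorially equivalent to the convex hull in $\mathbb{R}^{d+1}$ of the $2^{d+1}$ vectors $(\pm1,\ldots,\pm1)$. The link of a vertex $v$ in a polytope $P$ is the set of faces of $P$ that do not contain $v$ but lie in a facet of $P$ that contains $v$. The graph of the link is the graph whose vertices and edges are the vertices ($0$-faces) and edges ($1$-faces) of $P$ belonging to the link. A graph $G$ is $k$-linked if it has at least $2k$ vertices and, for every set of $2k$ distinct vertices of $G$ and every partition of this set into $k$ pairs $\{s_1,t_1\},\ldots,\{s_k,t_k\}$, there exist $k$ pairwise vertex-disjoint paths $L_1,\ldots,L_k$ in $G$ such that $L_i$ joins $s_i$ and $t_i$ for each $i$. *)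

theory Defs
  imports "HOL-Analysis.Analysis" "Graph_Theory.Pair_Digraph" "Graph_Theory.Vertex_Walk"
begin

definition standard_cube :: "(real ^ 'n) set" where
  "standard_cube = convex hull {x. \<forall>i. x $ i = 1 \<or> x $ i = -1}"

text \<open>Combinatorial equivalence: the face lattices are isomorphic.\<close>

definition combinatorially_equivalent ::
    "'a::euclidean_space set \<Rightarrow> 'b::euclidean_space set \<Rightarrow> bool" where
  "combinatorially_equivalent P Q \<longleftrightarrow>
     (\<exists>f. bij_betw f {F. F face_of P} {G. G face_of Q} \<and>
          (\<forall>F F'. F face_of P \<longrightarrow> F' face_of P \<longrightarrow> (F \<subseteq> F' \<longleftrightarrow> f F \<subseteq> f F')))"

definition polytope_link :: "'a::euclidean_space set \<Rightarrow> 'a \<Rightarrow> 'a set set" where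
  "polytope_link P v =
     {F. F face_of P \<and> v \<notin> F \<and> (\<exists>F'. F' facet_of P \<and> v \<in> F' \<and> F \<subseteq> F')}"

text \<open>
  An undirected graph is represented as a symmetric digraph, each edge giving
  one arc in either direction. The extreme points of a 1-dimensional face of a
  polytope are the two endpoints of that edge.
\<close>

definition face_graph :: "'a::euclidean_space set set \<Rightarrow> 'a pair_pre_digraph" where
  "face_graph C =
     \<lparr> pverts = {x. {x} \<in> C},
       parcs = {(x, y). x \<noteq> y \<and>
         (\<exists>F\<in>C. aff_dim F = 1 \<and> x extreme_point_of F \<and> y extreme_point_of F)} \<rparr>"

text \<open>
  Intended for finite symmetric digraphs. The \<open>2 * k\<close> terminals are pairwise
  distinct, and a path may be traversed in either direction.
\<close>

definition k_linked :: "nat \<Rightarrow> ('a, 'b) pre_digraph \<Rightarrow> bool" where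
  "k_linked k G \<longleftrightarrow>
     2 * k \<le> card (verts G) \<and>
     (\<forall>s t :: nat \<Rightarrow> 'a.
        s ` {..<k} \<subseteq> verts G \<longrightarrow> t ` {..<k} \<subseteq> verts G \<longrightarrow>
        inj_on s {..<k} \<longrightarrow> inj_on t {..<k} \<longrightarrow> s ` {..<k} \<inter> t ` {..<k} = {} \<longrightarrow>
        (\<exists>L :: nat \<Rightarrow> 'a vwalk.
           (\<forall>i<k. vpath (L i) G \<and> hd (L i) = s i \<and> last (L i) = t i) \<and>
           disjoint_family_on (\<lambda>i. set (L i)) {..<k}))"

end

theory Submission
  imports Defs
begin

text \<open>Let \<open>n = d + 1\<close>. In a face lattice isomorphic to that of the
\<open>n\<close>-cube, a vertex different from \<open>v\<close> lies in a common facet with \<open>v\<close> unless it is the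
antipode of \<open>v\<close>, and so does every edge that avoids \<open>v\<close> and its antipode. So
the graph of the link is the graph of the \<open>n\<close>-cube without two antipodal vertices
(\<open>link_contains_punctured_cube\<close>), and it must be shown that at most \<open>n\<close> terminals
in it, split into pairs, can be linked. For \<open>n = 3\<close> this graph is a hexagon; the case \<open>n = 4\<close> is excluded.

For \<open>n \<ge> 5\<close> the idea is to halve the cube in a direction in which no two terminals
are adjacent, to move all terminals to one half along the edges of that direction, to link them
there, and to use the other half for repairs. By a form of Bondy's theorem
(\<open>collision_free_direction\<close>) such a direction exists for up to \<open>n\<close> vertices. In the half chosen,
the terminals are at most \<open>n\<close> vertices of an \<open>(n - 1)\<close>-cube, which can be linked by
\<open>linkable_subcube\<close>: every \<open>m\<close>-cube with \<open>m \<ge> 4\<close> links any pairs and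
avoids any obstacles that have at most \<open>m + 1\<close> vertices in total.

The linking in one half may have used the removed vertex in that half. At most one connection
is broken in this way. It is mended through the other half, where at most half of the terminals
lie, so that by the connectivity of the cube (\<open>conn_subcube_diff\<close>) the vertices which the
other pairs leave free are still connected (\<open>linkable_minus_antipodes\<close>).

The theorem \<open>linkable_subcube\<close> is proved by the same method. There the
terminals exceed by one what a half can link, so one of them is ignored during the projection, and the
other half is used for its pair. The induction starts with the 4-cube, where two pairs have to be
linked around one obstacle (\<open>two_pairs_in_4_cube\<close>); it cannot start with the 3-cube, which is not
2-linked.\<close>


section \<open>Cube graphs and their subcubes\<close>

definition flip :: "'n \<Rightarrow> ('n \<Rightarrow> bool) \<Rightarrow> 'n \<Rightarrow> bool" where
  "flip i x = x(i := \<not> x i)"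

text \<open>The directions in \<open>D\<close> are free and the other coordinates are those of \<open>b\<close>. The base
point \<open>b\<close> is kept so that both halves of a subcube are subcubes again
(\<open>subcube_half\<close>), which is what the inductions on \<open>card D\<close> run on.\<close>
definition subcube :: "'n set \<Rightarrow> ('n \<Rightarrow> bool) \<Rightarrow> ('n \<Rightarrow> bool) set" where
  "subcube D b = {x. \<forall>j. j \<notin> D \<longrightarrow> x j = b j}"

definition adj :: "('n \<Rightarrow> bool) \<Rightarrow> ('n \<Rightarrow> bool) \<Rightarrow> bool" where
  "adj x y \<longleftrightarrow> (\<exists>i. y = flip i x)"

lemma flip_flip [simp]: "flip i (flip i x) = x"
  by (auto simp: flip_def fun_eq_iff)

lemma flip_apply [simp]: "flip i x j = (if j = i then \<not> x i else x j)"
  by (auto simp: flip_def)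

lemma flip_neq [simp]: "flip i x \<noteq> x" "x \<noteq> flip i x"
  by (auto simp: fun_eq_iff)

lemma flip_inject [simp]: "flip i x = flip i y \<longleftrightarrow> x = y"
  by (metis flip_flip)

lemma flip_eq_iff: "flip i x = y \<longleftrightarrow> x = flip i y"
  by (metis flip_flip)

lemma flip_index_inject [simp]: "flip i x = flip j x \<longleftrightarrow> i = j"
proof
  assume "flip i x = flip j x"
  then have "flip i x i = flip j x i"
    by simp
  then show "i = j"
    by (simp split: if_splits)
qed simp

lemma adj_flip [simp]: "adj x (flip i x)" "adj (flip i x) x"
  by (auto simp: adj_def intro!: exI [of _ i])

lemma adj_sym: "adj x y \<Longrightarrow> adj y x"
  unfolding adj_def using flip_flip by metis

lemma adj_irrefl [simp]: "\<not> adj x x"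
  by (auto simp: adj_def)

lemma flip_in_subcube [simp]: "i \<in> D \<Longrightarrow> flip i x \<in> subcube D b \<longleftrightarrow> x \<in> subcube D b"
  by (auto simp: subcube_def)

lemma subcube_UNIV [simp]: "subcube UNIV b = UNIV"
  by (simp add: subcube_def)

lemma subcube_half:
  assumes "i \<in> D"
  shows "subcube (D - {i}) (b(i := c)) = {x \<in> subcube D b. x i = c}"
  using assms by (auto simp: subcube_def)

lemma subcube_differ:
  assumes "x \<in> subcube D b" "y \<in> subcube D b" "x \<noteq> y"
  obtains i where "i \<in> D" "x i \<noteq> y i"
proof -
  obtain i where "x i \<noteq> y i"
    using assms(3) by (auto simp: fun_eq_iff)
  moreover from this have "i \<in> D"
    using assms(1,2) unfolding subcube_def by force
  ultimately show ?thesis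
    by (rule that [rotated])
qed

lemma subcube_finite_card:
  assumes "finite D"
  shows "finite (subcube D b) \<and> card (subcube D b) = 2 ^ card D"
proof -
  have inj: "inj_on (\<lambda>x. {i \<in> D. x i}) (subcube D b)"
  proof (intro inj_onI ext)
    fix x y j
    assume "x \<in> subcube D b" "y \<in> subcube D b" and eq: "{i \<in> D. x i} = {i \<in> D. y i}"
    then have "j \<notin> D \<Longrightarrow> x j = y j"
      by (simp add: subcube_def)
    moreover have "j \<in> D \<Longrightarrow> x j = y j"
      using eq by blast
    ultimately show "x j = y j"
      by blast
  qed
  have "(\<lambda>x. {i \<in> D. x i}) ` subcube D b = Pow D"
  proof
    show "Pow D \<subseteq> (\<lambda>x. {i \<in> D. x i}) ` subcube D b"
    proof
      fix A assume "A \<in> Pow D"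
      then have "A = {i \<in> D. (if i \<in> D then i \<in> A else b i)}"
        by auto
      moreover have "(\<lambda>i. if i \<in> D then i \<in> A else b i) \<in> subcube D b"
        by (auto simp: subcube_def)
      ultimately show "A \<in> (\<lambda>x. {i \<in> D. x i}) ` subcube D b"
        by (rule image_eqI)
    qed
  qed auto
  with inj have "bij_betw (\<lambda>x. {i \<in> D. x i}) (subcube D b) (Pow D)"
    by (simp add: bij_betw_def)
  then show ?thesis
    using assms bij_betw_finite [of _ "subcube D b" "Pow D"]
      bij_betw_same_card [of _ "subcube D b" "Pow D"] card_Pow [of D] by simp
qed

lemmas finite_subcube [simp] = subcube_finite_card [THEN conjunct1]
lemmas card_subcube = subcube_finite_card [THEN conjunct2]


section \<open>Connected vertex sets\<close>

text \<open>A connection between two vertices is represented by a connected vertex set containing both of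
them. Such a set need not be minimal: it can be a whole half of a cube minus a few vertices, so
gluing and rerouting need no bookkeeping along paths. A path is extracted only at the very end, in
\<open>conn_imp_vpath\<close>.\<close>
definition conn :: "('n \<Rightarrow> bool) set \<Rightarrow> bool" where
  "conn A \<longleftrightarrow> (\<forall>x\<in>A. \<forall>y\<in>A. (\<lambda>u v. u \<in> A \<and> v \<in> A \<and> adj u v)\<^sup>*\<^sup>* x y)"

lemma conn_empty [simp]: "conn {}"
  by (simp add: conn_def)

lemma conn_card_le_1: "finite A \<Longrightarrow> card A \<le> 1 \<Longrightarrow> conn A"
  by (auto simp: conn_def card_le_Suc0_iff_eq)

lemma conn_attach:
  assumes B: "conn B" "B \<subseteq> A" and att: "\<And>x. x \<in> A \<Longrightarrow> x \<in> B \<or> (\<exists>y\<in>B. adj x y)"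
  shows "conn A"
proof -
  let ?R = "\<lambda>u v. u \<in> A \<and> v \<in> A \<and> adj u v"
  have core: "?R\<^sup>*\<^sup>* x y" if "x \<in> B" "y \<in> B" for x y
  proof -
    have "(\<lambda>u v. u \<in> B \<and> v \<in> B \<and> adj u v)\<^sup>*\<^sup>* x y"
      using B(1) that by (simp add: conn_def)
    then show ?thesis
      by (rule rtranclp_mono [THEN predicate2D, rotated]) (use B(2) in auto)
  qed
  have "\<exists>y\<in>B. ?R\<^sup>*\<^sup>* x y \<and> ?R\<^sup>*\<^sup>* y x" if x: "x \<in> A" for x
  proof (cases "x \<in> B")
    case False
    then obtain y where "y \<in> B" "adj x y"
      using att x by blast
    then show ?thesis
      using x B(2) adj_sym by (intro bexI [of _ y]) auto
  qed auto
  then show ?thesis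
    unfolding conn_def using core by (blast intro: rtranclp_trans)
qed

lemma conn_Un:
  assumes A: "conn A" and B: "conn B" and "A \<inter> B \<noteq> {}"
  shows "conn (A \<union> B)"
proof -
  let ?R = "\<lambda>u v. u \<in> A \<union> B \<and> v \<in> A \<union> B \<and> adj u v"
  obtain z where z: "z \<in> A" "z \<in> B"
    using assms by blast
  have "?R\<^sup>*\<^sup>* x y" if "C \<in> {A, B}" "x \<in> C" "y \<in> C" for x y C
  proof -
    have "(\<lambda>u v. u \<in> C \<and> v \<in> C \<and> adj u v)\<^sup>*\<^sup>* x y"
      using A B that by (auto simp: conn_def)
    then show ?thesis
      by (rule rtranclp_mono [THEN predicate2D, rotated]) (use that in auto)
  qed
  then have "?R\<^sup>*\<^sup>* x z \<and> ?R\<^sup>*\<^sup>* z x" if "x \<in> A \<union> B" for x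
    using z that by blast
  then show ?thesis
    unfolding conn_def by (blast intro: rtranclp_trans)
qed

lemma conn_neighbour:
  assumes "conn A" "x \<in> A" "y \<in> A" "x \<noteq> y"
  obtains z where "z \<in> A" "adj x z"
proof -
  have "(\<lambda>u v. u \<in> A \<and> v \<in> A \<and> adj u v)\<^sup>*\<^sup>* x y"
    using assms by (auto simp: conn_def)
  then show ?thesis
    using \<open>x \<noteq> y\<close> that by (cases rule: converse_rtranclpE) auto
qed

text \<open>The \<open>n\<close>-cube is \<open>n\<close>-connected. Halve it. If one half contains no deleted vertex, it
is connected and every remaining vertex is adjacent to it. Otherwise each half has lost fewer
vertices than its dimension, so both are connected by induction, and one of the
\<open>2 ^ (n - 1)\<close> edges between them survives.\<close>
lemma conn_subcube_diff:
  assumes "finite D" "finite S" "card S < card D"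
  shows "conn (subcube D b - S)"
  using assms
proof (induction "card D" arbitrary: D b S)
  case 0
  then show ?case by simp
next
  case (Suc n)
  have "D \<noteq> {}"
    using Suc.hyps(2) by auto
  then obtain i where i: "i \<in> D"
    by blast
  define H where "H c = subcube (D - {i}) (b(i := c))" for c
  have H: "H c = {x \<in> subcube D b. x i = c}" for c
    unfolding H_def using i by (rule subcube_half)
  have n: "n = card (D - {i})" "finite (D - {i})"
    using Suc i by auto
  have cardH: "card (H c) = 2 ^ n" for c
    unfolding H_def n(1) by (rule card_subcube) (use n in simp)
  have IH: "conn (H c - S)" if "card (S \<inter> H c) < n" for c
  proof -
    have "conn (H c - (S \<inter> H c))"
      unfolding H_def by (rule Suc.hyps(1)) (use that n Suc.prems H_def in auto)
    then show ?thesis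
      by (simp add: Diff_Int)
  qed
  have split: "card (S \<inter> H True) + card (S \<inter> H False) \<le> n"
  proof -
    have "card (S \<inter> H True) + card (S \<inter> H False) = card (S \<inter> H True \<union> S \<inter> H False)"
      using Suc.prems(2) by (subst card_Un_disjoint) (auto simp: H)
    also have "\<dots> \<le> card S"
      using Suc.prems(2) by (intro card_mono) auto
    finally show ?thesis
      using Suc by simp
  qed
  show ?case
  proof (cases "\<exists>c. S \<inter> H c = {}")
    case True
    then obtain c where c: "S \<inter> H c = {}"
      by blast
    have "conn (H c - S)"
    proof (cases "n = 0")
      case True
      then have "card (H c - S) \<le> 1" "finite (H c - S)"
        using cardH [of c] c n by (auto simp: H_def Diff_triv Int_commute)
      then show ?thesis
        by (simp add: conn_card_le_1)
    next
      case False
      then show ?thesis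
        using c by (intro IH) simp
    qed
    then show ?thesis
    proof (rule conn_attach)
      fix x assume x: "x \<in> subcube D b - S"
      show "x \<in> H c - S \<or> (\<exists>y\<in>H c - S. adj x y)"
      proof (cases "x i = c")
        case True
        then show ?thesis
          using x by (simp add: H)
      next
        case False
        then have "flip i x \<in> H c"
          using x i by (simp add: H)
        then have "flip i x \<in> H c - S"
          using c by blast
        then show ?thesis
          by (intro disjI2 bexI [of _ "flip i x"]) simp_all
      qed
    qed (auto simp: H)
  next
    case False
    then have pos: "card (S \<inter> H c) > 0" for c
      using Suc.prems(2) by (simp add: card_gt_0_iff)
    have conns: "conn (H c - S)" for c
      using pos [of "\<not> c"] split by (intro IH) (cases c; simp)
    have "\<exists>x\<in>H True. x \<notin> S \<and> flip i x \<notin> S"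
    proof (rule ccontr)
      assume no: "\<not> (\<exists>x\<in>H True. x \<notin> S \<and> flip i x \<notin> S)"
      then have "H True \<subseteq> (S \<inter> H True) \<union> flip i ` (S \<inter> H False)"
      proof (intro subsetI)
        fix x assume x: "x \<in> H True"
        then have "flip i x \<in> H False" "x \<in> S \<or> flip i x \<in> S"
          using i no by (auto simp: H)
        then show "x \<in> (S \<inter> H True) \<union> flip i ` (S \<inter> H False)"
          using x image_eqI [of x "flip i" "flip i x" "S \<inter> H False"] by auto
      qed
      then have "2 ^ n \<le> card ((S \<inter> H True) \<union> flip i ` (S \<inter> H False))"
        unfolding cardH [of True, symmetric] using Suc.prems(2) by (intro card_mono) auto
      also have "\<dots> \<le> card (S \<inter> H True) + card (S \<inter> H False)"
        using Suc.prems(2)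
        by (intro order_trans [OF card_Un_le] add_left_mono card_image_le) simp
      also have "\<dots> \<le> n"
        by (rule split)
      finally show False
        using less_exp [of n] by simp
    qed
    then obtain x where "x \<in> H True" "x \<notin> S" "flip i x \<notin> S"
      by blast
    then have x: "x \<in> H True - S" "flip i x \<in> H False - S"
      using i by (auto simp: H)
    have "conn (insert (flip i x) (H True - S))"
      using conns [of True]
      by (rule conn_attach) (use x in \<open>auto intro!: bexI [of _ x]\<close>)
    then have "conn (insert (flip i x) (H True - S) \<union> (H False - S))"
      using conns [of False] x by (intro conn_Un) auto
    moreover have "insert (flip i x) (H True - S) \<union> (H False - S) = subcube D b - S"
      using x Diff_iff by (auto simp: H)
    ultimately show ?thesis
      by simp
  qed
qed

section \<open>Directions without collisions\<close>

text \<open>A form of Bondy's theorem: the edges spanned by a nonempty set \<open>X\<close> of cube vertices have fewer than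
\<open>card X\<close> directions. Cutting \<open>X\<close> along one of these directions leaves two nonempty parts, and an
edge in any other direction lies inside one of the parts, so induction gives at most
\<open>1 + (card Y - 1) + (card Z - 1)\<close> directions for parts \<open>Y\<close> and \<open>Z\<close>.\<close>
lemma collision_directions:
  assumes "finite X" "X \<noteq> {}"
  shows "finite {i. \<exists>x\<in>X. flip i x \<in> X} \<and> card {i. \<exists>x\<in>X. flip i x \<in> X} < card X"
  using assms
proof (induction "card X" arbitrary: X rule: less_induct)
  case less
  let ?d = "\<lambda>X. {i. \<exists>x\<in>X. flip i x \<in> X}"
  show ?case
  proof (cases "?d X = {}")
    case True
    then show ?thesis
      unfolding True using less.prems by (simp add: card_gt_0_iff)
  next
    case False
    then obtain i x where i: "x \<in> X" "flip i x \<in> X"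
      by blast
    define Y where "Y c = {y \<in> X. y i = c}" for c
    have sum: "card (Y True) + card (Y False) = card X"
      using less.prems(1) unfolding Y_def
      by (subst card_Un_disjoint [symmetric]) (auto intro: arg_cong [where f = card])
    have ne: "Y c \<noteq> {}" for c
      using i by (cases "x i = c") (auto simp: Y_def)
    have fin: "finite (Y c)" for c
      using less.prems(1) by (simp add: Y_def)
    have pos: "card (Y c) > 0" for c
      using ne fin by (simp add: card_gt_0_iff)
    have IH: "finite (?d (Y c)) \<and> card (?d (Y c)) < card (Y c)" for c
      using pos [of "\<not> c"] sum by (intro less.hyps ne fin) (cases c; simp)
    have sub: "?d X \<subseteq> insert i (?d (Y True) \<union> ?d (Y False))"
    proof (intro subsetI)
      fix j assume "j \<in> ?d X"
      then obtain y where y: "y \<in> X" "flip j y \<in> X"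
        by blast
      show "j \<in> insert i (?d (Y True) \<union> ?d (Y False))"
      proof (cases "j = i")
        case False
        then have "y \<in> Y (y i)" "flip j y \<in> Y (y i)"
          using y by (auto simp: Y_def)
        then show ?thesis
          by (cases "y i") auto
      qed simp
    qed
    have "card (?d X) \<le> card (insert i (?d (Y True) \<union> ?d (Y False)))"
      using IH by (intro card_mono sub) auto
    also have "\<dots> \<le> Suc (card (?d (Y True) \<union> ?d (Y False)))"
      using IH by (simp add: card_insert_if)
    also have "\<dots> \<le> Suc (card (?d (Y True)) + card (?d (Y False)))"
      by (simp add: card_Un_le)
    finally have "card (?d X) \<le> Suc (card (?d (Y True)) + card (?d (Y False)))" .
    moreover have "finite (?d X)"
      using IH by (intro finite_subset [OF sub]) auto
    ultimately show ?thesis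
      using IH [of True] IH [of False] sum by simp
  qed
qed

text \<open>In such a direction the whole of \<open>X\<close> can be moved into either half of the cube without two
vertices meeting.\<close>
lemma collision_free_direction:
  assumes "finite X" "card X \<le> card D" "finite D" "D \<noteq> {}"
  obtains i where "i \<in> D" "\<And>x. x \<in> X \<Longrightarrow> flip i x \<notin> X"
proof (cases "X = {}")
  case True
  then show ?thesis using that assms(4) by blast
next
  case False
  have "\<not> D \<subseteq> {i. \<exists>x\<in>X. flip i x \<in> X}"
  proof
    assume "D \<subseteq> {i. \<exists>x\<in>X. flip i x \<in> X}"
    then have "card D \<le> card {i. \<exists>x\<in>X. flip i x \<in> X}"
      using collision_directions [OF assms(1) False] by (intro card_mono) auto
    then show False
      using collision_directions [OF assms(1) False] assms(2) by simp
  qed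
  then show ?thesis using that by blast
qed

section \<open>Two pairs in the 4-cube\<close>

text \<open>Deleting as many vertices as the dimension can disconnect a cube, but in the 3-cube only by
isolating a vertex. The three deleted vertices can be cut into one and two by some direction. The
half losing one vertex stays connected, and a vertex of the other half reaches it directly or after
one step to its free neighbour.\<close>
lemma linked_in_3_cube:
  assumes D: "card D = 3" "finite D" and S: "finite S" "card S \<le> 3"
    and s: "s \<in> subcube D b - S" "s' \<in> subcube D b - S" "adj s s'"
    and t: "t \<in> subcube D b - S" "t' \<in> subcube D b - S" "adj t t'"
  obtains C where "conn C" "C \<subseteq> subcube D b - S" "s \<in> C" "t \<in> C"
proof (cases "card (S \<inter> subcube D b) < 3")
  case True
  then have "conn (subcube D b - S \<inter> subcube D b)"
    using D S by (intro conn_subcube_diff) auto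
  then have "conn (subcube D b - S)"
    by (simp add: Diff_Int)
  then show ?thesis
    using that s t by blast
next
  case False
  let ?S = "S \<inter> subcube D b"
  have card3: "card ?S \<le> 3"
    using S card_mono [of S ?S] by auto
  have "\<not> card ?S \<le> Suc 0"
    using False by simp
  then obtain x y where xy: "x \<in> ?S" "y \<in> ?S" "x \<noteq> y"
    using S card_le_Suc0_iff_eq [of ?S] by blast
  then obtain j where j: "j \<in> D" "x j \<noteq> y j"
    using subcube_differ [of x D b y] by blast
  define K where "K c = {z \<in> ?S. z j = c}" for c
  have "finite ?S"
    using S by simp
  then have finK: "finite (K c)" for c
    by (rule finite_subset [rotated]) (auto simp: K_def)
  have "card (K True \<union> K False) = card (K True) + card (K False)"
    by (intro card_Un_disjoint finK) (auto simp: K_def)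
  moreover have "K True \<union> K False = ?S"
    by (auto simp: K_def)
  ultimately have sum: "card (K True) + card (K False) \<le> 3"
    using card3 by simp
  have "x \<in> K (x j)" "y \<in> K (y j)"
    using xy by (auto simp: K_def)
  then have "card (K (x j)) > 0" "card (K (y j)) > 0"
    using finK by (auto simp: card_gt_0_iff)
  then have "card (K True) = 1 \<or> card (K False) = 1"
    using sum j(2) by (cases "x j"; cases "y j") auto
  then obtain c where c: "card (K c) = 1"
    by blast
  define H where "H = subcube (D - {j}) (b(j := c))"
  have H: "z \<in> H \<longleftrightarrow> z \<in> subcube D b \<and> z j = c" for z
    unfolding H_def subcube_half [OF j(1)] by simp
  have cardD': "card (D - {j}) = 2" "finite (D - {j})"
    using D j by auto
  have "conn (H - K c)"
    unfolding H_def by (rule conn_subcube_diff) (use cardD' c finK in auto)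
  moreover have "H - K c = H - S"
    by (auto simp: H K_def)
  ultimately have core: "conn (H - S)"
    by simp
  have "card H = 4"
    unfolding H_def using card_subcube [of "D - {j}"] cardD' by simp
  moreover have "card (K c) \<ge> card H" if "H - S = {}"
    using that finK by (intro card_mono) (auto simp: H K_def)
  ultimately have ne: "H - S \<noteq> {}"
    using c by auto
  have reach: "\<exists>C. conn C \<and> C \<subseteq> subcube D b - S \<and> p \<in> C \<and> H - S \<subseteq> C"
    if p: "p \<in> subcube D b - S" "p' \<in> subcube D b - S" "adj p p'" for p p'
  proof -
    consider "p \<in> H" | "flip j p \<in> H - S" | "p \<notin> H" "flip j p \<in> S"
      using p j by (auto simp: H)
    then show ?thesis
    proof cases
      case 1
      then show ?thesis
        using core p by (intro exI [of _ "H - S"]) (auto simp: H)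
    next
      case 2
      have "conn (insert p (H - S))"
        using core by (rule conn_attach) (use 2 in \<open>auto intro!: bexI [of _ "flip j p"]\<close>)
      then show ?thesis
        using p by (intro exI [of _ "insert p (H - S)"]) (auto simp: H)
    next
      case 3
      have "flip j p \<in> K c"
        using 3 p j by (auto simp: H K_def)
      have p'H: "p' \<notin> H"
      proof
        assume "p' \<in> H"
        then have "p' = flip j p"
          using p 3(1) by (auto simp: H adj_def split: if_splits)
        then show False
          using p 3(2) by simp
      qed
      have "flip j p' \<noteq> flip j p"
        using p by auto
      then have "flip j p' \<notin> K c"
        using c \<open>flip j p \<in> K c\<close> by (metis card_1_singletonE singletonD)
      moreover have "flip j p' \<in> H"
        using p'H p j by (auto simp: H)
      ultimately have p'': "flip j p' \<in> H - S"
        by (auto simp: H K_def)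
      have "conn (insert p' (H - S))"
        using core by (rule conn_attach) (use p'' in \<open>auto intro!: bexI [of _ "flip j p'"]\<close>)
      then have "conn (insert p (insert p' (H - S)))"
        by (rule conn_attach) (use p in auto)
      then show ?thesis
        using p by (intro exI [of _ "insert p (insert p' (H - S))"]) (auto simp: H)
    qed
  qed
  obtain A B where A: "conn A" "A \<subseteq> subcube D b - S" "s \<in> A" "H - S \<subseteq> A"
      and B: "conn B" "B \<subseteq> subcube D b - S" "t \<in> B" "H - S \<subseteq> B"
    using reach [OF s] reach [OF t] by blast
  have "conn (A \<union> B)"
    using A B ne by (intro conn_Un) auto
  then show ?thesis
    using A B by (intro that [of "A \<union> B"]) auto
qed

text \<open>The 4-cube minus any vertex \<open>z\<close> is 2-linked. This starts the induction and has to be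
treated separately, because the halves of the 4-cube are not 2-linked: two pairs may alternate
around a 4-cycle of the 3-cube.

Halve the cube in a direction in which the four terminals have no collisions. If a terminal lies
outside the half of \<open>z\<close>, then the pairs can be distributed so that each half serves one
pair: it gives all its vertices outside the other pair and \<open>z\<close>, which are connected, and
the terminals of its pair that lie in the other half step over. If all five vertices lie in one
half, one pair uses the opposite half, and the other pair stays. Staying is possible for one of the
pairs: if a terminal of the second pair is enclosed by the other three vertices, then these are
pairwise at distance two, and the terminals of the first pair have free neighbours.\<close>
lemma two_pairs_in_4_cube:
  assumes D: "card D = 4" "finite D"
    and Q: "{s1, t1, s2, t2, z} \<subseteq> subcube D b"
    and dist: "distinct [s1, t1, s2, t2, z]"
  obtains A B where "conn A" "conn B" "A \<union> B \<subseteq> subcube D b - {z}" "A \<inter> B = {}"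
    "{s1, t1} \<subseteq> A" "{s2, t2} \<subseteq> B"
proof -
  let ?X = "{s1, t1, s2, t2}"
  have "finite ?X" "card ?X \<le> card D" "D \<noteq> {}"
    using D by (auto simp: card_insert_if)
  then obtain i where i: "i \<in> D" and cf: "\<And>x. x \<in> ?X \<Longrightarrow> flip i x \<notin> ?X"
    using collision_free_direction [of ?X D] D(2) by blast
  define G where "G c = subcube (D - {i}) (b(i := c))" for c
  have G: "x \<in> G c \<longleftrightarrow> x \<in> subcube D b \<and> x i = c" for x c
    unfolding G_def subcube_half [OF i] by simp
  have D': "card (D - {i}) = 3" "finite (D - {i})"
    using D i by auto
  define g where "g = z i"
  have zG: "z \<in> G g"
    using Q by (simp add: G g_def)
  have zG': "z \<notin> G (\<not> g)"
    by (simp add: G g_def)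
  have GQ: "G c \<subseteq> subcube D b" and GG: "G c \<inter> G (\<not> c) = {}" for c
    by (auto simp: G)
  define linked where "linked p q r s \<longleftrightarrow> (\<exists>A B. conn A \<and> conn B \<and> A \<union> B \<subseteq> subcube D b - {z} \<and>
      A \<inter> B = {} \<and> {p, q} \<subseteq> A \<and> {r, s} \<subseteq> B)" for p q r s
  have swap: "linked p q r s" if "linked r s p q" for p q r s
    using that unfolding linked_def by (metis Int_commute Un_commute)
  \<comment> \<open>The half of \<open>z\<close> serves the pair \<open>p, q\<close>, the other half serves \<open>r, s\<close>.\<close>
  have separate: "linked p q r s"
    if sub: "{p, q, r, s} = ?X" and dis: "distinct [p, q, r, s]"
      and rs: "\<not> (r \<in> G g \<and> s \<in> G g)" and pq: "flip i z \<notin> {p, q}" for p q r s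
  proof -
    have mem: "p \<in> subcube D b" "q \<in> subcube D b" "r \<in> subcube D b" "s \<in> subcube D b"
      "z \<notin> {p, q, r, s}"
      using sub Q dist by auto
    have small: "conn (G c - S)" if "finite S" "card (G c \<inter> S) \<le> 2" for c S
    proof -
      have "conn (G c - (G c \<inter> S))"
        unfolding G_def by (rule conn_subcube_diff) (use that D' G_def in auto)
      then show ?thesis
        by (simp add: Diff_Int)
    qed
    have "card (G g \<inter> {r, s, z}) \<le> 2"
    proof -
      obtain u where "G g \<inter> {r, s, z} \<subseteq> {u, z}"
        using rs by blast
      then have "card (G g \<inter> {r, s, z}) \<le> card {u, z}"
        by (intro card_mono) auto
      also have "\<dots> \<le> 2"
        by (simp add: card_insert_if)
      finally show ?thesis .
    qed
    then have coreA: "conn (G g - {r, s, z})"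
      by (intro small) auto
    have "card (G (\<not> g) \<inter> {p, q}) \<le> card {p, q}"
      by (intro card_mono) auto
    also have "\<dots> \<le> 2"
      by (simp add: card_insert_if)
    finally have coreB: "conn (G (\<not> g) - {p, q})"
      by (intro small) auto
    have A: "conn ({p, q} \<union> (G g - {r, s, z}))"
    proof (rule conn_attach [OF coreA])
      fix x assume x: "x \<in> {p, q} \<union> (G g - {r, s, z})"
      show "x \<in> G g - {r, s, z} \<or> (\<exists>y\<in>G g - {r, s, z}. adj x y)"
      proof (cases "x \<in> G g - {r, s, z}")
        case False
        then have pqx: "x \<in> {p, q}"
          using x by blast
        then have "x \<notin> {r, s, z}" "x \<in> subcube D b"
          using dis mem by auto
        then have "flip i x \<in> G g"
          using False i by (auto simp: G)
        moreover have "flip i x \<notin> {r, s}"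
          using cf [of x] pqx sub by blast
        moreover have "flip i x \<noteq> z"
          using pq pqx flip_eq_iff by metis
        ultimately show ?thesis
          by (intro disjI2 bexI [of _ "flip i x"]) auto
      qed simp
    qed auto
    have B: "conn ({r, s} \<union> (G (\<not> g) - {p, q}))"
    proof (rule conn_attach [OF coreB])
      fix x assume x: "x \<in> {r, s} \<union> (G (\<not> g) - {p, q})"
      show "x \<in> G (\<not> g) - {p, q} \<or> (\<exists>y\<in>G (\<not> g) - {p, q}. adj x y)"
      proof (cases "x \<in> G (\<not> g) - {p, q}")
        case False
        then have rsx: "x \<in> {r, s}"
          using x by blast
        then have "x \<notin> {p, q}" "x \<in> subcube D b"
          using dis mem by auto
        then have "flip i x \<in> G (\<not> g)"
          using False i by (auto simp: G)
        moreover have "flip i x \<notin> {p, q}"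
          using cf [of x] rsx sub by blast
        ultimately show ?thesis
          by (intro disjI2 bexI [of _ "flip i x"]) auto
      qed simp
    qed auto
    show ?thesis
      unfolding linked_def
    proof (intro exI conjI)
      show "({p, q} \<union> (G g - {r, s, z})) \<union> ({r, s} \<union> (G (\<not> g) - {p, q})) \<subseteq> subcube D b - {z}"
        using mem zG' GQ by blast
      show "({p, q} \<union> (G g - {r, s, z})) \<inter> ({r, s} \<union> (G (\<not> g) - {p, q})) = {}"
        using dis GG [of g] by auto
    qed (use A B in auto)
  qed
  \<comment> \<open>The pair \<open>p, q\<close> uses the half that contains none of the five vertices.\<close>
  have through: "linked p q r s"
    if sub: "{p, q, r, s} = ?X" and dis: "distinct [p, q, r, s]"
      and inG: "?X \<subseteq> G g" and free: "\<And>x. x \<in> {r, s} \<Longrightarrow> \<exists>k\<in>D - {i}. flip k x \<notin> {p, q, z}"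
    for p q r s
  proof -
    have mem: "p \<in> G g" "q \<in> G g" "r \<in> G g" "s \<in> G g" "z \<notin> {p, q, r, s}"
      using sub inG dist by auto
    obtain k l where k: "k \<in> D - {i}" "flip k r \<notin> {p, q, z}"
        and l: "l \<in> D - {i}" "flip l s \<notin> {p, q, z}"
      using free [of r] free [of s] by auto
    have card: "finite {p, q, z}" "card {p, q, z} \<le> 3"
      by (auto simp: card_insert_if)
    have nbr: "flip k r \<in> G g - {p, q, z}" "flip l s \<in> G g - {p, q, z}"
      using mem k l by (auto simp: G)
    have rs: "r \<in> G g - {p, q, z}" "s \<in> G g - {p, q, z}"
      using mem dis by auto
    have "\<exists>B. conn B \<and> B \<subseteq> G g - {p, q, z} \<and> r \<in> B \<and> s \<in> B"
    proof (rule linked_in_3_cube [OF D' card, of r "b(i := g)" "flip k r" s "flip l s", folded G_def])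
    qed (use rs nbr in auto)
    then obtain B where B: "conn B" "B \<subseteq> G g - {p, q, z}" "r \<in> B" "s \<in> B"
      by blast
    have "conn (G (\<not> g) - {})"
      unfolding G_def using D' by (intro conn_subcube_diff) auto
    then have core: "conn (G (\<not> g))"
      by simp
    have conn: "conn ({p, q} \<union> G (\<not> g))"
    proof (rule conn_attach [OF core])
      fix x assume x: "x \<in> {p, q} \<union> G (\<not> g)"
      show "x \<in> G (\<not> g) \<or> (\<exists>y\<in>G (\<not> g). adj x y)"
      proof (cases "x \<in> G (\<not> g)")
        case False
        then have "flip i x \<in> G (\<not> g)"
          using x mem i by (auto simp: G)
        then show ?thesis
          by (intro disjI2 bexI [of _ "flip i x"]) auto
      qed simp
    qed auto
    show ?thesis
      unfolding linked_def
    proof (intro exI conjI)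
      show "({p, q} \<union> G (\<not> g)) \<union> B \<subseteq> subcube D b - {z}"
        using mem zG' GQ B by blast
      show "({p, q} \<union> G (\<not> g)) \<inter> B = {}"
        using B GG [of g] by blast
    qed (use B conn in auto)
  qed
  have "linked s1 t1 s2 t2"
  proof (cases "?X \<subseteq> G g")
    case False
    then consider "\<not> (s2 \<in> G g \<and> t2 \<in> G g)" "flip i z \<notin> {s1, t1}"
      | "\<not> (s1 \<in> G g \<and> t1 \<in> G g)" "flip i z \<notin> {s2, t2}"
    proof -
      have "flip i z \<notin> G g"
        by (simp add: G g_def)
      then show ?thesis
        using False dist that by auto
    qed
    then show ?thesis
    proof cases
      case 1
      then show ?thesis
        using dist by (intro separate) auto
    next
      case 2
      then show ?thesis
        using dist by (intro swap [OF separate]) auto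
    qed
  next
    case True
    show ?thesis
    proof (cases "\<forall>x\<in>{s2, t2}. \<exists>k\<in>D - {i}. flip k x \<notin> {s1, t1, z}")
      case True
      then show ?thesis
        using dist \<open>?X \<subseteq> G g\<close> by (intro through) auto
    next
      case False
      then obtain r where r: "r \<in> {s2, t2}" "(\<lambda>k. flip k r) ` (D - {i}) \<subseteq> {s1, t1, z}"
        by blast
      have "card ((\<lambda>k. flip k r) ` (D - {i})) = card {s1, t1, z}"
        using D' dist by (subst card_image) (auto simp: inj_on_def)
      then have nbrs: "(\<lambda>k. flip k r) ` (D - {i}) = {s1, t1, z}"
        using r by (intro card_subset_eq) auto
      \<comment> \<open>The vertex \<open>x\<close> and \<open>z\<close> are neighbours of \<open>r\<close> in directions \<open>k\<close> and \<open>m\<close>. A further step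
        from \<open>x\<close> in either remaining direction leads to neither \<open>r\<close> nor \<open>z\<close>, and only one of these
        two steps can lead to the partner of \<open>r\<close>.\<close>
      have free1: "\<exists>l\<in>D - {i}. flip l x \<notin> {s2, t2, z}" if x: "x \<in> {s1, t1}" for x
      proof -
        have "x \<in> (\<lambda>k. flip k r) ` (D - {i})" "z \<in> (\<lambda>k. flip k r) ` (D - {i})"
          unfolding nbrs using x by auto
        then obtain k m where k: "k \<in> D - {i}" "x = flip k r" and m: "z = flip m r"
          by blast
        have "k \<noteq> m"
          using dist x k m by auto
        have "card (D - {i} - {k}) = 2"
          using D' k by simp
        then obtain l1 l2 where l: "D - {i} - {k} = {l1, l2}" "l1 \<noteq> l2"
          by (meson card_2_iff)
        have far: "flip l x \<noteq> r \<and> flip l x \<noteq> z" if "l \<noteq> k" for l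
        proof -
          have "flip l x k \<noteq> r k" "z k = r k"
            using that \<open>k \<noteq> m\<close> by (auto simp: k m)
          then show ?thesis
            by auto
        qed
        obtain q where q: "{s2, t2} = {r, q}"
          using r by blast
        have "flip l1 x \<noteq> q \<or> flip l2 x \<noteq> q"
          using l by (metis flip_index_inject)
        moreover have "l1 \<in> D - {i}" "l2 \<in> D - {i}" "l1 \<noteq> k" "l2 \<noteq> k"
          using l by auto
        ultimately obtain l where "l \<in> D - {i}" "l \<noteq> k" "flip l x \<noteq> q"
          by blast
        then show ?thesis
          using far [of l] q by (intro bexI [of _ l]) auto
      qed
      have "linked s2 t2 s1 t1"
      proof (rule through)
        show "{s2, t2, s1, t1} = ?X"
          by auto
        show "distinct [s2, t2, s1, t1]"
          using dist by auto
        show "?X \<subseteq> G g"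
          by fact
      qed (rule free1)
      then show ?thesis
        by (rule swap)
    qed
  qed
  then obtain A B where "conn A" "conn B" "A \<union> B \<subseteq> subcube D b - {z}" "A \<inter> B = {}"
      "{s1, t1} \<subseteq> A" "{s2, t2} \<subseteq> B"
    unfolding linked_def by auto
  then show ?thesis
    by (rule that)
qed

section \<open>Linking pairs in cubes of dimension at least four\<close>

definition linkable :: "('n \<Rightarrow> bool) set \<Rightarrow> 'i set \<Rightarrow> ('i \<Rightarrow> ('n \<Rightarrow> bool) set) \<Rightarrow> bool" where
  "linkable W I T \<longleftrightarrow>
     (\<exists>C. (\<forall>j\<in>I. T j \<subseteq> C j \<and> C j \<subseteq> W \<and> conn (C j)) \<and> disjoint_family_on C I)"

text \<open>A set \<open>T j\<close> with one element is a vertex that the other connections have to avoid. Thus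
obstacles and pairs are treated alike, and ignoring one vertex of a pair leaves the other one as an
obstacle.\<close>
definition pairing :: "('n \<Rightarrow> bool) set \<Rightarrow> 'i set \<Rightarrow> ('i \<Rightarrow> ('n \<Rightarrow> bool) set) \<Rightarrow> bool" where
  "pairing W I T \<longleftrightarrow> (\<forall>j\<in>I. T j \<subseteq> W \<and> card (T j) \<le> 2) \<and> disjoint_family_on T I"

lemma linkableE:
  assumes "linkable W I T"
  obtains C where "\<forall>j\<in>I. T j \<subseteq> C j \<and> C j \<subseteq> W \<and> conn (C j)"
    "\<forall>j\<in>I. \<forall>l\<in>I. \<forall>x. x \<in> C j \<longrightarrow> x \<in> C l \<longrightarrow> j = l"
  using assms unfolding linkable_def disjoint_family_on_def by (metis disjoint_iff)

lemma linkableI: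
  assumes "\<And>j. j \<in> I \<Longrightarrow> T j \<subseteq> C j" "\<And>j. j \<in> I \<Longrightarrow> C j \<subseteq> W" "\<And>j. j \<in> I \<Longrightarrow> conn (C j)"
    "\<And>j l x. j \<in> I \<Longrightarrow> l \<in> I \<Longrightarrow> x \<in> C j \<Longrightarrow> x \<in> C l \<Longrightarrow> j = l"
  shows "linkable W I T"
  unfolding linkable_def disjoint_family_on_def
  by (rule exI [of _ C]) (use assms in blast)

lemma pairingI:
  assumes "\<And>j. j \<in> I \<Longrightarrow> T j \<subseteq> W" "\<And>j. j \<in> I \<Longrightarrow> card (T j) \<le> 2"
    "\<And>j l x. j \<in> I \<Longrightarrow> l \<in> I \<Longrightarrow> x \<in> T j \<Longrightarrow> x \<in> T l \<Longrightarrow> j = l"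
  shows "pairing W I T"
  unfolding pairing_def disjoint_family_on_def using assms by blast

lemma pairingD:
  assumes "pairing W I T"
  shows "j \<in> I \<Longrightarrow> T j \<subseteq> W" "j \<in> I \<Longrightarrow> card (T j) \<le> 2"
    "j \<in> I \<Longrightarrow> l \<in> I \<Longrightarrow> x \<in> T j \<Longrightarrow> x \<in> T l \<Longrightarrow> j = l"
  using assms unfolding pairing_def disjoint_family_on_def by blast+

lemma card_le_1_subset_singleton:
  assumes "finite R" "card R \<le> 1" "z \<in> R"
  shows "R \<subseteq> {z}"
  using assms by (auto simp: card_le_Suc0_iff_eq)

text \<open>Five vertices allow two proper pairs at most. With two pairs, \<open>two_pairs_in_4_cube\<close> applies
to them and the remaining vertex; with one pair, the connectivity of the cube suffices.\<close>
lemma linkable_4_cube: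
  assumes D: "card D = 4" "finite D"
    and T: "pairing (subcube D b) I T" and X: "card (\<Union>j\<in>I. T j) \<le> 5"
  shows "linkable (subcube D b) I T"
proof -
  let ?Q = "subcube D b" and ?X = "\<Union>j\<in>I. T j"
  note TQ = pairingD(1) [OF T] and T2 = pairingD(2) [OF T] and Tdis = pairingD(3) [OF T]
  have finX: "finite ?X"
    using TQ D(2) by (intro finite_subset [of ?X ?Q]) auto
  have finT: "finite (T j)" if "j \<in> I" for j
    using TQ [OF that] D(2) finite_subset finite_subcube by metis
  have T1: "conn (T j)" if "j \<in> I" "card (T j) \<noteq> 2" for j
    using T2 [OF that(1)] that finT by (intro conn_card_le_1) auto
  show ?thesis
  proof (cases "\<exists>j\<in>I. card (T j) = 2")
    case False
    then show ?thesis
      using T1 TQ Tdis by (intro linkableI [where C = T]) auto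
  next
    case True
    then obtain j where j: "j \<in> I" "card (T j) = 2"
      by blast
    have card_rest: "card (?X - T j) \<le> 3"
    proof -
      have "T j \<subseteq> ?X"
        using j by auto
      then show ?thesis
        using card_Diff_subset [of "T j" ?X] finT j X by simp
    qed
    show ?thesis
    proof (cases "\<exists>l\<in>I. l \<noteq> j \<and> card (T l) = 2")
      case False
      define C where "C = T(j := ?Q - (?X - T j))"
      have "conn (?Q - (?X - T j))"
        using D finX card_rest by (intro conn_subcube_diff) auto
      then have "conn (C l)" if "l \<in> I" for l
        using that T1 False by (auto simp: C_def)
      moreover have "T l \<subseteq> C l" "C l \<subseteq> ?Q" if "l \<in> I" for l
        using that TQ by (auto simp: C_def)
      moreover have "l = m" if "l \<in> I" "m \<in> I" "x \<in> C l" "x \<in> C m" for l m x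
        using that Tdis by (auto simp: C_def split: if_splits)
      ultimately show ?thesis
        by (intro linkableI [where C = C]) auto
    next
      case True
      then obtain l where l: "l \<in> I" "l \<noteq> j" "card (T l) = 2"
        by blast
      obtain s1 t1 where st1: "T j = {s1, t1}" "s1 \<noteq> t1"
        using j(2) by (meson card_2_iff)
      obtain s2 t2 where st2: "T l = {s2, t2}" "s2 \<noteq> t2"
        using l(3) by (meson card_2_iff)
      let ?P = "{s1, t1, s2, t2}"
      have P: "?P = T j \<union> T l"
        using st1 st2 by auto
      have sep: "T j \<inter> T l = {}"
        using Tdis [OF j(1) l(1)] l(2) by auto
      have cardP: "card ?P = 4"
        unfolding P using card_Un_disjoint [OF _ _ sep] finT j l by simp
      have "?P \<subseteq> ?X"
        unfolding P using j l by auto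
      then have "card (?X - ?P) \<le> 1"
        using card_Diff_subset [of ?P ?X] cardP X by simp
      moreover have "\<not> ?Q \<subseteq> ?P"
        using card_mono [of ?P ?Q] cardP card_subcube [of D b] D by auto
      ultimately obtain z where z: "z \<in> ?Q" "z \<notin> ?P" "?X - ?P \<subseteq> {z}"
      proof (cases "?X - ?P = {}")
        case True
        then show ?thesis
          using that \<open>\<not> ?Q \<subseteq> ?P\<close> by blast
      next
        case False
        then obtain z where "z \<in> ?X - ?P"
          by blast
        moreover have "?X - ?P \<subseteq> {z}"
          by (rule card_le_1_subset_singleton) (use calculation finX \<open>card (?X - ?P) \<le> 1\<close> in blast)+
        moreover have "z \<in> ?Q"
          using calculation TQ by blast
        ultimately show ?thesis
          using that by blast
      qed
      have "{s1, t1, s2, t2, z} \<subseteq> ?Q"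
        using z TQ [OF j(1)] TQ [OF l(1)] st1 st2 by simp
      moreover have "distinct [s1, t1, s2, t2, z]"
        using st1 st2 sep z by auto
      ultimately obtain A B where AB: "conn A" "conn B" "A \<union> B \<subseteq> ?Q - {z}" "A \<inter> B = {}"
          "{s1, t1} \<subseteq> A" "{s2, t2} \<subseteq> B"
        by (rule two_pairs_in_4_cube [OF D])
      define C where "C = T(j := A, l := B)"
      have rest: "T m \<subseteq> {z}" if "m \<in> I" "m \<noteq> j" "m \<noteq> l" for m
      proof
        fix x assume x: "x \<in> T m"
        then have "x \<notin> ?P"
          unfolding P using Tdis that j l by blast
        then show "x \<in> {z}"
          using x z(3) that(1) by blast
      qed
      then have small: "card (T m) \<noteq> 2" if "m \<in> I" "m \<noteq> j" "m \<noteq> l" for m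
        using card_mono [of "{z}" "T m"] that by fastforce
      have "conn (C m)" if "m \<in> I" for m
        using that T1 small AB by (auto simp: C_def)
      moreover have "T m \<subseteq> C m" "C m \<subseteq> ?Q" if "m \<in> I" for m
        using that TQ AB st1 st2 by (auto simp: C_def)
      moreover have "m = k" if "m \<in> I" "k \<in> I" "x \<in> C m" "x \<in> C k" for m k x
      proof (rule ccontr)
        assume "m \<noteq> k"
        have zAB: "z \<notin> A" "z \<notin> B"
          using AB by auto
        have "x \<notin> A \<or> x \<notin> B"
          using AB by auto
        moreover have "x = z" if "i \<in> {m, k}" "i \<noteq> j" "i \<noteq> l" for i
          using that rest [of i] \<open>m \<in> I\<close> \<open>k \<in> I\<close> \<open>x \<in> C m\<close> \<open>x \<in> C k\<close> by (auto simp: C_def)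
        ultimately show False
          using that \<open>m \<noteq> k\<close> Tdis [of m k x] zAB by (auto simp: C_def split: if_splits)
      qed
      ultimately show ?thesis
        by (intro linkableI [where C = C]) auto
    qed
  qed
qed

text \<open>The projection of the cube onto its half \<open>{x. x i = c}\<close>. Unlike the function update
\<open>x(i := c)\<close>, this form shows that a vertex moves along an edge or not at all.\<close>
definition push :: "'n \<Rightarrow> bool \<Rightarrow> ('n \<Rightarrow> bool) \<Rightarrow> 'n \<Rightarrow> bool" where
  "push i c x = (if x i = c then x else flip i x)"

lemma inj_on_push:
  assumes "\<And>x. x \<in> Y \<Longrightarrow> flip i x \<notin> Y"
  shows "inj_on (push i c) Y"
proof (rule inj_onI)
  fix x y assume xy: "x \<in> Y" "y \<in> Y" "push i c x = push i c y"
  then consider "x = y" | "x = flip i y" | "flip i x = y"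
    by (auto simp: push_def split: if_splits)
  then show "x = y"
    using assms xy by cases auto
qed

lemma conn_Un_push:
  assumes "conn C" "push i c ` T \<subseteq> C"
  shows "conn (T \<union> C)"
  using assms(1)
proof (rule conn_attach)
  fix x assume x: "x \<in> T \<union> C"
  show "x \<in> C \<or> (\<exists>y\<in>C. adj x y)"
  proof (cases "x \<in> C")
    case False
    then have "push i c x \<in> C"
      using x assms(2) by blast
    then show ?thesis
      by (cases "x i = c") (auto simp: push_def intro!: bexI [of _ "flip i x"])
  qed simp
qed auto

lemma pairing_push:
  assumes T: "pairing W I T" and inj: "inj_on (push i c) ((\<Union>j\<in>I. T j) - S)"
    and W: "push i c ` W \<subseteq> W'" and fin: "finite W"
  shows "pairing W' I (\<lambda>j. push i c ` (T j - S))"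
proof (rule pairingI)
  fix j assume j: "j \<in> I"
  have TW: "T j \<subseteq> W"
    using pairingD(1) [OF T j] .
  then show "push i c ` (T j - S) \<subseteq> W'"
    using W by blast
  have "finite (T j)"
    using TW fin finite_subset by blast
  then have "card (push i c ` (T j - S)) \<le> card (T j)"
    by (meson Diff_subset card_image_le card_mono finite_Diff order_trans)
  then show "card (push i c ` (T j - S)) \<le> 2"
    using pairingD(2) [OF T j] by simp
next
  fix j l x assume jl: "j \<in> I" "l \<in> I"
    and x: "x \<in> push i c ` (T j - S)" "x \<in> push i c ` (T l - S)"
  then obtain y z where "y \<in> T j - S" "x = push i c y" "z \<in> T l - S" "x = push i c z"
    by blast
  moreover from this have "y = z"
    using inj jl unfolding inj_on_def by blast
  ultimately show "j = l"
    using pairingD(3) [OF T jl, of y] by blast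
qed

text \<open>The half \<open>{x. x i \<noteq> c}\<close> with the minority of the terminals is the one with room for rerouting.\<close>
lemma majority_value:
  fixes X :: "('n \<Rightarrow> bool) set"
  assumes "finite X"
  obtains c where "2 * card {x \<in> X. x i \<noteq> c} \<le> card X"
proof -
  have "card X = card ({x \<in> X. x i} \<union> {x \<in> X. \<not> x i})"
    by (intro arg_cong [where f = card]) auto
  also have "\<dots> = card {x \<in> X. x i} + card {x \<in> X. \<not> x i}"
    using assms by (intro card_Un_disjoint) auto
  finally have "2 * card {x \<in> X. x i \<noteq> True} \<le> card X \<or> 2 * card {x \<in> X. x i \<noteq> False} \<le> card X"
    by auto
  then show ?thesis
    using that by blast
qed

text \<open>In an \<open>n\<close>-cube with \<open>n \<ge> 4\<close>, disjoint pairs and obstacles with at most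
\<open>n + 1\<close> vertices in total can be linked. A half admits only \<open>n\<close> vertices by induction, so
one vertex \<open>x0\<close> is ignored and the other ones are projected to the half with the majority,
in a direction in which they have no collisions. If \<open>x0\<close> can be chosen in the minority half,
the pair of \<open>x0\<close> is linked through that half: it contains at most
\<open>(n + 1) / 2\<close> terminals, too few to disconnect it. If that half contains no terminals at all, any
vertex \<open>e\<close> may be ignored; then the connection running through \<open>e\<close>, if there is one,
has to be rerouted too, and the empty half links these two pairs by induction.\<close>
theorem linkable_subcube:
  assumes "finite D" "4 \<le> card D" "pairing (subcube D b) I T" "card (\<Union>j\<in>I. T j) \<le> card D + 1"
  shows "linkable (subcube D b) I T"
  using assms
proof (induction "card D" arbitrary: D b T rule: less_induct)
  case less
  let ?Q = "subcube D b" and ?X = "\<Union>j\<in>I. T j"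
  note D = less.prems(1) and T = less.prems(3)
  note TQ = pairingD(1) [OF T] and T2 = pairingD(2) [OF T] and Tdis = pairingD(3) [OF T]
  have XQ: "?X \<subseteq> ?Q"
    using TQ by blast
  then have finX: "finite ?X"
    by (rule finite_subset) (use D in simp)
  consider "card D = 4" | "?X = {}" | "card D \<ge> 5" "?X \<noteq> {}"
    using less.prems(2) by linarith
  then show ?case
  proof cases
    case 1
    then show ?thesis
      using less.prems by (intro linkable_4_cube) auto
  next
    case 2
    then have "T j = {}" if "j \<in> I" for j
      using that by blast
    then show ?thesis
      by (intro linkableI [where C = "\<lambda>_. {}"]) auto
  next
    case 3
    then obtain e where e: "e \<in> ?X"
      by blast
    have "card (?X - {e}) \<le> card D"
      using less.prems(4) e finX by simp
    moreover have "D \<noteq> {}"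
      using 3 by auto
    ultimately obtain i where i: "i \<in> D"
        and cf: "\<And>x. x \<in> ?X - {e} \<Longrightarrow> flip i x \<notin> ?X - {e}"
      using collision_free_direction [of "?X - {e}" D] D finX by blast
    obtain c where c: "2 * card {x \<in> ?X. x i \<noteq> c} \<le> card ?X"
      using majority_value [OF finX] by blast
    define H where "H a = subcube (D - {i}) (b(i := a))" for a
    have H: "x \<in> H a \<longleftrightarrow> x \<in> ?Q \<and> x i = a" for x a
      unfolding H_def subcube_half [OF i] by simp
    have D': "card (D - {i}) = card D - 1" "finite (D - {i})"
      using D i by auto
    have IH: "linkable (H a) I T'" if "pairing (H a) I T'" "card (\<Union>j\<in>I. T' j) \<le> card D" for a T'
      unfolding H_def by (rule less.hyps) (use that D' 3 i D H_def in auto)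
    define A where "A = {x \<in> ?X. x i \<noteq> c}"
    have finA: "finite A"
      unfolding A_def by (rule finite_subset [OF _ finX]) auto
    show ?thesis
    proof (cases "A = {}")
      case True
      \<comment> \<open>All terminals lie in one half. Ignore \<open>e\<close> there, and use the other half, which is empty,
        for the pair of \<open>e\<close> and for the pair whose connection passes through \<open>e\<close>.\<close>
      then have XH: "?X \<subseteq> H c"
      proof (intro subsetI)
        fix x assume x: "x \<in> ?X"
        then have "x i = c"
          using True unfolding A_def by blast
        then show "x \<in> H c"
          using subsetD [OF XQ x] by (simp add: H)
      qed
      obtain k where k: "k \<in> I" "e \<in> T k"
        using e by blast
      define T' where "T' j = T j - {e}" for j
      have "pairing (H c) I T'"
      proof (rule pairingI)
        fix j assume j: "j \<in> I"
        show "T' j \<subseteq> H c"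
          using XH j by (auto simp: T'_def)
        have "finite (T j)"
          using finX j by (meson UN_upper finite_subset)
        then have "card (T' j) \<le> card (T j)"
          unfolding T'_def by (intro card_mono) auto
        then show "card (T' j) \<le> 2"
          using T2 [OF j] by simp
      next
        fix j l x assume "j \<in> I" "l \<in> I" "x \<in> T' j" "x \<in> T' l"
        then show "j = l"
          using Tdis [of j l x] by (simp add: T'_def)
      qed
      moreover have "(\<Union>j\<in>I. T' j) = ?X - {e}"
        by (auto simp: T'_def)
      ultimately have "linkable (H c) I T'"
        using \<open>card (?X - {e}) \<le> card D\<close> by (intro IH) simp_all
      then obtain C where C': "\<forall>j\<in>I. T' j \<subseteq> C j \<and> C j \<subseteq> H c \<and> conn (C j)"
        and "\<forall>j\<in>I. \<forall>l\<in>I. \<forall>x. x \<in> C j \<longrightarrow> x \<in> C l \<longrightarrow> j = l"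
        by (rule linkableE)
      then have C: "\<And>j. j \<in> I \<Longrightarrow> T' j \<subseteq> C j" "\<And>j. j \<in> I \<Longrightarrow> C j \<subseteq> H c"
          "\<And>j. j \<in> I \<Longrightarrow> conn (C j)"
        and Cdis: "\<And>j l x. j \<in> I \<Longrightarrow> l \<in> I \<Longrightarrow> x \<in> C j \<Longrightarrow> x \<in> C l \<Longrightarrow> j = l"
        by blast+
      define J where "J = {j \<in> I. j = k \<or> e \<in> C j}"
      obtain m where m: "m \<in> I" "J \<subseteq> {k, m}"
      proof (cases "\<exists>m\<in>I. e \<in> C m")
        case True
        then obtain m where "m \<in> I" "e \<in> C m"
          by blast
        have "J \<subseteq> {k, m}"
        proof
          fix j assume "j \<in> J"
          then show "j \<in> {k, m}"
            using Cdis [of j m e] \<open>m \<in> I\<close> \<open>e \<in> C m\<close> by (auto simp: J_def)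
        qed
        then show ?thesis
          by (rule that [OF \<open>m \<in> I\<close>])
      next
        case False
        then show ?thesis
          using k by (intro that [of k]) (auto simp: J_def)
      qed
      define S where "S j = (if j \<in> J then push i (\<not> c) ` (T j - {}) else {})" for j
      have inj: "inj_on (push i (\<not> c)) (?X - {})"
      proof (rule inj_on_push)
        fix x assume "x \<in> ?X - {}"
        then have "x \<in> H c"
          using XH by blast
        then have "flip i x \<notin> H c"
          by (simp add: H)
        then show "flip i x \<notin> ?X - {}"
          using XH by blast
      qed
      have "push i (\<not> c) ` ?Q \<subseteq> H (\<not> c)"
        using i by (auto simp: push_def H)
      then have pS: "pairing (H (\<not> c)) I (\<lambda>j. push i (\<not> c) ` (T j - {}))"
        using inj D by (intro pairing_push [OF T]) auto
      have "pairing (H (\<not> c)) I S"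
      proof (rule pairingI)
        fix j assume "j \<in> I"
        then show "S j \<subseteq> H (\<not> c)" "card (S j) \<le> 2"
          using pairingD(1,2) [OF pS] by (auto simp: S_def)
      next
        fix j l x assume "j \<in> I" "l \<in> I" "x \<in> S j" "x \<in> S l"
        then show "j = l"
          using pairingD(3) [OF pS, of j l x] by (auto simp: S_def split: if_splits)
      qed
      moreover have "card (\<Union>j\<in>I. S j) \<le> card D"
      proof -
        have fin: "finite (T j)" if "j \<in> I" for j
          using finX that by (meson UN_upper finite_subset)
        have "(\<Union>j\<in>I. S j) \<subseteq> push i (\<not> c) ` (T k \<union> T m)"
          using m by (auto simp: S_def split: if_splits)
        then have "card (\<Union>j\<in>I. S j) \<le> card (push i (\<not> c) ` (T k \<union> T m))"
          using fin k m by (intro card_mono) auto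
        also have "\<dots> \<le> card (T k \<union> T m)"
          using fin k m by (intro card_image_le) auto
        also have "\<dots> \<le> card (T k) + card (T m)"
          by (rule card_Un_le)
        also have "\<dots> \<le> 4"
          using T2 [OF k(1)] T2 [OF m(1)] by simp
        finally show ?thesis
          using 3 by simp
      qed
      ultimately have "linkable (H (\<not> c)) I S"
        by (rule IH)
      then obtain B where B': "\<forall>j\<in>I. S j \<subseteq> B j \<and> B j \<subseteq> H (\<not> c) \<and> conn (B j)"
        and "\<forall>j\<in>I. \<forall>l\<in>I. \<forall>x. x \<in> B j \<longrightarrow> x \<in> B l \<longrightarrow> j = l"
        by (rule linkableE)
      then have B: "\<And>j. j \<in> I \<Longrightarrow> S j \<subseteq> B j" "\<And>j. j \<in> I \<Longrightarrow> B j \<subseteq> H (\<not> c)"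
          "\<And>j. j \<in> I \<Longrightarrow> conn (B j)"
        and Bdis: "\<And>j l x. j \<in> I \<Longrightarrow> l \<in> I \<Longrightarrow> x \<in> B j \<Longrightarrow> x \<in> B l \<Longrightarrow> j = l"
        by blast+
      define E where "E j = (if j \<in> J then T j \<union> B j else C j)" for j
      show ?thesis
      proof (rule linkableI [where C = E])
        fix j assume j: "j \<in> I"
        show "conn (E j)"
        proof (cases "j \<in> J")
          case True
          then have "push i (\<not> c) ` T j \<subseteq> B j"
            using B(1) [OF j] by (simp add: S_def)
          then show ?thesis
            using conn_Un_push [OF B(3) [OF j]] True by (simp add: E_def)
        qed (use C(3) [OF j] in \<open>simp add: E_def\<close>)
        show "T j \<subseteq> E j"
        proof (cases "j \<in> J")
          case False
          then have "j \<noteq> k"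
            using k by (auto simp: J_def)
          then have "e \<notin> T j"
            using Tdis [of j k e] j k by blast
          then show ?thesis
            using C(1) [OF j] False by (auto simp: E_def T'_def)
        qed (simp add: E_def)
        show "E j \<subseteq> ?Q"
          using TQ [OF j] B(2) [OF j] C(2) [OF j] by (auto simp: E_def H)
      next
        fix j l x assume jl: "j \<in> I" "l \<in> I" and x: "x \<in> E j" "x \<in> E l"
        have half: "x i = c" if "x \<in> T j \<or> x \<in> C j" "j \<in> I" for j
          using that XH C(2) [OF that(2)] by (auto simp: H)
        have half': "x i \<noteq> c" if "x \<in> B j" "j \<in> I" for j
          using that B(2) [OF that(2)] by (auto simp: H)
        have TC: False if "j \<in> J" "l \<in> I" "l \<notin> J" "x \<in> T j" "x \<in> C l" for j l
        proof (cases "x = e")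
          case True
          then show False
            using that by (auto simp: J_def)
        next
          case False
          then have "x \<in> C j"
            using that C(1) [of j] by (auto simp: T'_def J_def)
          then show False
            using Cdis [of j l x] that by (auto simp: J_def)
        qed
        show "j = l"
        proof (cases "j \<in> J"; cases "l \<in> J")
          assume "j \<in> J" "l \<in> J"
          then show ?thesis
            using x half half' jl Tdis [OF jl] Bdis [OF jl] by (auto simp: E_def)
        next
          assume "j \<in> J" "l \<notin> J"
          then show ?thesis
            using x half half' jl TC [of j l] by (auto simp: E_def)
        next
          assume "j \<notin> J" "l \<in> J"
          then show ?thesis
            using x half half' jl TC [of l j] by (auto simp: E_def)
        next
          assume "j \<notin> J" "l \<notin> J"
          then show ?thesis
            using x Cdis [OF jl] by (simp add: E_def)
        qed
      qed
    next
      case False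
      \<comment> \<open>All collisions in direction \<open>i\<close> involve \<open>e\<close>, so there is at most one. Its end in \<open>A\<close> can
        be ignored instead of \<open>e\<close>; without collisions any vertex of \<open>A\<close> will do.\<close>
      obtain x0 where x0: "x0 \<in> A" and cf0: "\<And>x. x \<in> ?X - {x0} \<Longrightarrow> flip i x \<notin> ?X - {x0}"
      proof (cases "\<exists>x\<in>A. flip i x \<in> ?X")
        case True
        then obtain x where x: "x \<in> A" "flip i x \<in> ?X"
          by blast
        have xe: "x = e \<or> flip i x = e"
          using cf [of x] x by (auto simp: A_def)
        show ?thesis
        proof (rule that [OF x(1)])
          fix y assume y: "y \<in> ?X - {x}"
          show "flip i y \<notin> ?X - {x}"
          proof
            assume y': "flip i y \<in> ?X - {x}"
            then have "y = e \<or> flip i y = e"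
              using cf [of y] y by blast
            then show False
              using xe y y' by auto
          qed
        qed
      next
        case False
        obtain x where x: "x \<in> A"
          using \<open>A \<noteq> {}\<close> by blast
        show ?thesis
        proof (rule that [OF x])
          fix y assume y: "y \<in> ?X - {x}"
          show "flip i y \<notin> ?X - {x}"
          proof
            assume y': "flip i y \<in> ?X - {x}"
            show False
            proof (cases "y i = c")
              case True
              then have "flip i y \<in> A"
                using y' by (simp add: A_def)
              then show False
                using False y by auto
            next
              case False
              then have "y \<in> A"
                using y by (simp add: A_def)
              then show False
                using \<open>\<not> (\<exists>x\<in>A. flip i x \<in> ?X)\<close> y' by auto
            qed
          qed
        qed
      qed
      obtain k where k: "k \<in> I" "x0 \<in> T k"
        using x0 by (auto simp: A_def)
      define T' where "T' j = push i c ` (T j - {x0})" for j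
      have "push i c ` ?Q \<subseteq> H c"
        using i by (auto simp: push_def H)
      then have "pairing (H c) I T'"
        unfolding T'_def using cf0 D
        by (intro pairing_push [OF T] inj_on_push) auto
      moreover have "card (\<Union>j\<in>I. T' j) \<le> card D"
      proof -
        have "(\<Union>j\<in>I. T' j) = push i c ` (?X - {x0})"
          by (auto simp: T'_def)
        then have "card (\<Union>j\<in>I. T' j) \<le> card (?X - {x0})"
          using finX by (simp add: card_image_le)
        also have "\<dots> \<le> card D"
          using x0 finX less.prems(4) by (simp add: A_def)
        finally show ?thesis .
      qed
      ultimately have "linkable (H c) I T'"
        by (rule IH)
      then obtain C where C': "\<forall>j\<in>I. T' j \<subseteq> C j \<and> C j \<subseteq> H c \<and> conn (C j)"
        and "\<forall>j\<in>I. \<forall>l\<in>I. \<forall>x. x \<in> C j \<longrightarrow> x \<in> C l \<longrightarrow> j = l"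
        by (rule linkableE)
      then have C: "\<And>j. j \<in> I \<Longrightarrow> T' j \<subseteq> C j" "\<And>j. j \<in> I \<Longrightarrow> C j \<subseteq> H c"
          "\<And>j. j \<in> I \<Longrightarrow> conn (C j)"
        and Cdis: "\<And>j l x. j \<in> I \<Longrightarrow> l \<in> I \<Longrightarrow> x \<in> C j \<Longrightarrow> x \<in> C l \<Longrightarrow> j = l"
        by blast+
      \<comment> \<open>The pair of \<open>x0\<close> gets all that the other pairs leave free in the minority half.\<close>
      define R where "R = H (\<not> c) - (?X - T k)"
      have "conn R"
      proof -
        have "A - T k \<subseteq> A - {x0}"
          using k by blast
        then have "card (A - T k) \<le> card (A - {x0})"
          using finA by (intro card_mono) auto
        also have "\<dots> = card A - 1"
          using x0 finA by simp
        also have "\<dots> < card D - 1"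
          using c less.prems(4) 3 unfolding A_def by linarith
        finally have "conn (H (\<not> c) - (A - T k))"
          unfolding H_def using D' finA by (intro conn_subcube_diff) auto
        moreover have "H (\<not> c) - (A - T k) = R"
          by (auto simp: R_def A_def H)
        ultimately show ?thesis
          by simp
      qed
      define E where "E j = (if j = k then T k \<union> R else T j \<union> C j)" for j
      have TC: "x \<in> C j" if "j \<in> I" "x \<in> T j" "x i = c" for j x
      proof -
        have "x \<noteq> x0"
          using x0 that by (auto simp: A_def)
        then have "push i c x \<in> T' j"
          using that by (auto simp: T'_def)
        then show ?thesis
          using C(1) that by (auto simp: push_def)
      qed
      show ?thesis
      proof (rule linkableI [where C = E])
        fix j assume j: "j \<in> I"
        show "conn (E j)"
        proof (cases "j = k")
          case True
          have "conn (T k \<union> R)"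
            using \<open>conn R\<close>
          proof (rule conn_attach)
            fix x assume x: "x \<in> T k \<union> R"
            show "x \<in> R \<or> (\<exists>y\<in>R. adj x y)"
            proof (cases "x \<in> R")
              case False
              then have xT: "x \<in> T k" "x \<in> ?Q"
                using x TQ k by auto
              then have "x i = c"
                using False by (auto simp: R_def H)
              then have "flip i x \<in> H (\<not> c)"
                using xT i by (simp add: H)
              moreover have "flip i x \<notin> ?X - T k"
              proof
                assume *: "flip i x \<in> ?X - T k"
                have "x \<noteq> x0"
                  using \<open>x i = c\<close> x0 by (auto simp: A_def)
                moreover have "flip i x \<noteq> x0"
                  using * k by blast
                ultimately show False
                  using cf0 [of x] * xT k by blast
              qed
              ultimately show ?thesis
                by (intro disjI2 bexI [of _ "flip i x"]) (simp_all add: R_def)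
            qed simp
          qed simp
          then show ?thesis
            using True by (simp add: E_def)
        next
          case False
          then have "x0 \<notin> T j"
            using Tdis [of j k x0] j k by blast
          then have "push i c ` T j \<subseteq> C j"
            using C(1) [OF j] by (simp add: T'_def)
          then show ?thesis
            using conn_Un_push [OF C(3) [OF j]] False by (simp add: E_def)
        qed
        show "T j \<subseteq> E j"
          by (simp add: E_def)
        show "E j \<subseteq> ?Q"
          using TQ [OF j] C(2) [OF j] k by (auto simp: E_def H R_def)
      next
        fix j l x assume jl: "j \<in> I" "l \<in> I" and x: "x \<in> E j" "x \<in> E l"
        have CC: "x i = c" if "x \<in> C j" "j \<in> I" for j
          using that C(2) [OF that(2)] by (auto simp: H)
        have Ek: False if l: "l \<in> I" "l \<noteq> k" and xk: "x \<in> T k \<union> R" and xl: "x \<in> T l \<union> C l" for l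
        proof (cases "x \<in> T k")
          case True
          then have "x \<notin> T l"
            using Tdis [of l k x] l k by blast
          then have "x \<in> C l"
            using xl by blast
          then show False
            using TC [of k x] True CC l k Cdis [of k l x] by blast
        next
          case False
          then have "x \<in> R"
            using xk by blast
          then have "x \<notin> T l" "x i \<noteq> c"
            using False l by (auto simp: R_def H)
          then show False
            using CC l xl by blast
        qed
        show "j = l"
        proof (cases "j = k \<or> l = k")
          case True
          then show ?thesis
            using Ek [of l] Ek [of j] jl x by (auto simp: E_def split: if_splits)
        next
          case False
          then have xx: "x \<in> T j \<union> C j" "x \<in> T l \<union> C l"
            using x by (auto simp: E_def)
          show ?thesis
          proof (cases "x i = c")
            case True
            then have "x \<in> C j" "x \<in> C l"
              using xx TC jl by auto
            then show ?thesis
              by (rule Cdis [OF jl])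
          next
            case False
            then have "x \<in> T j" "x \<in> T l"
              using xx CC jl by auto
            then show ?thesis
              by (rule Tdis [OF jl])
          qed
        qed
      qed
    qed
  qed
qed

section \<open>Removing two antipodal vertices\<close>

text \<open>Counting the two removed vertices as obstacles gives up to \<open>n + 2\<close> vertices, one more than
\<open>linkable_subcube\<close> admits. As the removed vertices \<open>v0\<close> and \<open>v1\<close> are antipodal, every direction
separates them. Take a direction without collisions among the terminals, and call \<open>v0\<close> the one in
the half with the minority of the terminals. All terminals are projected to the half of
\<open>v1\<close> and linked there as if \<open>v1\<close> were present. At most one connection runs through
\<open>v1\<close>. It gives up \<open>v1\<close> and receives in return all vertices of the minority half except \<open>v0\<close> and
the terminals of the other pairs. These vertices are connected to each other, and every remaining vertex of
the broken connection has its projection among them, except for the neighbour \<open>u\<close> of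
\<open>v0\<close>. But \<open>u\<close> is not adjacent to \<open>v1\<close>, so it keeps a neighbour in the connection.

The bound \<open>5 \<le> n\<close> is sharp: the 4-cube without two antipodal vertices is the graph of the
rhombic dodecahedron, and in this planar graph two pairs alternating around a face cannot be
linked.\<close>
theorem linkable_minus_antipodes:
  fixes v :: "'n::finite \<Rightarrow> bool"
  assumes n: "5 \<le> CARD('n)" and T: "pairing (UNIV - {v, \<lambda>j. \<not> v j}) I T"
    and X: "card (\<Union>j\<in>I. T j) \<le> CARD('n)"
  shows "linkable (UNIV - {v, \<lambda>j. \<not> v j}) I T"
proof -
  let ?X = "\<Union>j\<in>I. T j" and ?W = "UNIV - {v, \<lambda>j. \<not> v j}"
  note TW = pairingD(1) [OF T] and Tdis = pairingD(3) [OF T]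
  have fin: "finite Z" for Z :: "('n \<Rightarrow> bool) set"
    by (rule finite_subset [of _ "subcube UNIV v"]) simp_all
  obtain i where cf: "\<And>x. x \<in> ?X \<Longrightarrow> flip i x \<notin> ?X"
    using collision_free_direction [of ?X UNIV] fin X by auto
  obtain c where c: "2 * card {x \<in> ?X. x i \<noteq> c} \<le> card ?X"
    using majority_value [OF fin] by blast
  obtain v0 v1 where v: "{v, \<lambda>j. \<not> v j} = {v0, v1}" "v0 i \<noteq> c" "v1 = (\<lambda>j. \<not> v0 j)"
  proof (cases "v i = c")
    case True
    then show ?thesis
      by (intro that [of "\<lambda>j. \<not> v j" v]) auto
  next
    case False
    then show ?thesis
      by (intro that [of v "\<lambda>j. \<not> v j"]) auto
  qed
  have ne: "v1 \<noteq> x" if "x = flip a v0 \<or> x = flip a (flip b v0)" for x a b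
  proof -
    have "card {a, b} < CARD('n)"
      using n by (simp add: card_insert_if)
    then have "{a, b} \<noteq> UNIV"
      by (metis less_irrefl)
    then obtain m where "m \<noteq> a" "m \<noteq> b"
      by auto
    then have "v1 m \<noteq> x m"
      using that v(3) by auto
    then show ?thesis
      by auto
  qed
  define u where "u = flip i v0"
  define H where "H a = subcube (UNIV - {i}) (v(i := a))" for a
  have H: "x \<in> H a \<longleftrightarrow> x i = a" for x a
    unfolding H_def using subcube_half [of i UNIV v a] by simp
  have D': "card (UNIV - {i}) = CARD('n) - 1"
    by simp
  define T' where "T' j = push i c ` (T j - {})" for j
  have "inj_on (push i c) (?X - {})"
    by (rule inj_on_push) (use cf in auto)
  moreover have "push i c ` ?W \<subseteq> H c"
    by (auto simp: push_def H)
  ultimately have "pairing (H c) I T'"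
    unfolding T'_def by (intro pairing_push [OF T] fin)
  moreover have "card (\<Union>j\<in>I. T' j) \<le> CARD('n)"
  proof -
    have "(\<Union>j\<in>I. T' j) = push i c ` ?X"
      by (auto simp: T'_def)
    then have "card (\<Union>j\<in>I. T' j) \<le> card ?X"
      using fin by (simp add: card_image_le)
    then show ?thesis
      using X by simp
  qed
  ultimately have "linkable (H c) I T'"
    unfolding H_def using D' n by (intro linkable_subcube) auto
  then obtain C where C': "\<forall>j\<in>I. T' j \<subseteq> C j \<and> C j \<subseteq> H c \<and> conn (C j)"
    and "\<forall>j\<in>I. \<forall>l\<in>I. \<forall>x. x \<in> C j \<longrightarrow> x \<in> C l \<longrightarrow> j = l"
    by (rule linkableE)
  then have C: "\<And>j. j \<in> I \<Longrightarrow> T' j \<subseteq> C j" "\<And>j. j \<in> I \<Longrightarrow> C j \<subseteq> H c" "\<And>j. j \<in> I \<Longrightarrow> conn (C j)"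
    and Cdis: "\<And>j l x. j \<in> I \<Longrightarrow> l \<in> I \<Longrightarrow> x \<in> C j \<Longrightarrow> x \<in> C l \<Longrightarrow> j = l"
    by blast+
  have Cc: "x i = c" if "x \<in> C j" "j \<in> I" for x j
    using that C(2) [OF that(2)] by (auto simp: H)
  have TC: "push i c x \<in> C j" if "x \<in> T j" "j \<in> I" for x j
    using that C(1) [OF that(2)] by (auto simp: T'_def)
  have TC': "x \<in> C j" if "x \<in> T j" "j \<in> I" "x i = c" for x j
    using TC [OF that(1,2)] that(3) by (simp add: push_def)
  have Tv: "v0 \<notin> T j" "v1 \<notin> T j" if "j \<in> I" for j
    using TW [OF that] unfolding v(1) by auto
  define R where "R j = H (\<not> c) - insert v0 (?X - T j)" for j
  have connR: "conn (R j)" for j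
  proof -
    let ?A = "{x \<in> ?X. x i \<noteq> c}"
    have "card (insert v0 (?A - T j)) \<le> Suc (card (?A - T j))"
      by (rule card_insert_le_m1) simp_all
    also have "card (?A - T j) \<le> card ?A"
      by (rule card_mono [OF fin]) blast
    also have "Suc (card ?A) < CARD('n) - 1"
      using c X n by linarith
    finally have "conn (H (\<not> c) - insert v0 (?A - T j))"
      unfolding H_def using D' fin by (intro conn_subcube_diff) auto
    moreover have "H (\<not> c) - insert v0 (?A - T j) = R j"
      by (auto simp: R_def H)
    ultimately show ?thesis
      by simp
  qed
  define E where "E j = (if v1 \<in> C j then R j \<union> (C j - {v1}) else T j \<union> C j)" for j
  show ?thesis
  proof (rule linkableI [where C = E])
    fix j assume j: "j \<in> I"
    show "conn (E j)"
    proof (cases "v1 \<in> C j")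
      case False
      have "push i c ` T j \<subseteq> C j"
        using TC j by blast
      then show ?thesis
        using conn_Un_push [OF C(3) [OF j]] False by (simp add: E_def)
    next
      case True
      have "conn (R j \<union> (C j - {v1, u}))"
        using connR
      proof (rule conn_attach)
        fix x assume x: "x \<in> R j \<union> (C j - {v1, u})"
        show "x \<in> R j \<or> (\<exists>y\<in>R j. adj x y)"
        proof (cases "x \<in> R j")
          case False
          then have xC: "x \<in> C j" "x \<noteq> u"
            using x by auto
          then have "flip i x \<in> H (\<not> c)"
            using Cc [OF _ j] by (simp add: H)
          moreover have "flip i x \<noteq> v0"
            using xC unfolding u_def by auto
          moreover have "flip i x \<notin> ?X - T j"
          proof
            assume "flip i x \<in> ?X - T j"
            then obtain l where l: "l \<in> I" "flip i x \<in> T l" "l \<noteq> j"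
              by auto
            then have "x \<in> C l"
              using TC [OF l(2,1)] Cc [OF xC(1) j] by (simp add: push_def)
            then show False
              using Cdis [OF j l(1) xC(1)] l(3) by simp
          qed
          ultimately show ?thesis
            by (intro disjI2 bexI [of _ "flip i x"]) (simp_all add: R_def)
        qed simp
      qed simp
      moreover have "\<exists>y\<in>R j \<union> (C j - {v1, u}). adj u y" if uC: "u \<in> C j"
      proof -
        have "u \<noteq> v1"
          using ne [of u i] u_def by auto
        then obtain y where y: "y \<in> C j" "adj u y"
          using conn_neighbour [OF C(3) [OF j] uC True] by blast
        then have "y \<noteq> u" "y \<noteq> v1"
          using ne unfolding u_def adj_def by (auto simp: flip_eq_iff)
        then show ?thesis
          using y by blast
      qed
      ultimately have "conn (R j \<union> (C j - {v1}))"
        by (elim conn_attach) auto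
      then show ?thesis
        using True by (simp add: E_def)
    qed
    show "T j \<subseteq> E j"
    proof
      fix x assume x: "x \<in> T j"
      then have "x \<noteq> v0" "x \<noteq> v1"
        using Tv [OF j] by auto
      then show "x \<in> E j"
        using x TC' [OF x j] by (cases "x i = c") (auto simp: E_def R_def H)
    qed
    have "v1 i = c"
      using v by auto
    then have "v0 \<notin> C j" "v0 \<notin> R j" "v1 \<notin> R j"
      using v(2) Cc [OF _ j, of v0] by (auto simp: R_def H)
    then have "v0 \<notin> E j" "v1 \<notin> E j"
      using Tv [OF j] by (simp_all add: E_def)
    then show "E j \<subseteq> ?W"
      unfolding v(1) by blast
  next
    fix j l x assume jl: "j \<in> I" "l \<in> I" and x: "x \<in> E j" "x \<in> E l"
    have in_C: "x \<in> C j" if "x \<in> E j" "x i = c" "j \<in> I" for j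
      using that TC' [of x j] by (auto simp: E_def R_def H split: if_splits)
    have RT: "m = k" if "x \<in> R m" "x \<in> T k" "m \<in> I" "k \<in> I" for m k
      using that Tdis [of m k x] by (auto simp: R_def)
    have rest: "x \<in> (if v1 \<in> C m then R m else T m)" if "x \<in> E m" "x i \<noteq> c" "m \<in> I" for m
      using that Cc [of x m] by (auto simp: E_def split: if_splits)
    show "j = l"
    proof (cases "x i = c")
      case True
      then show ?thesis
        using in_C x jl by (intro Cdis [OF jl]) auto
    next
      case False
      show ?thesis
        using rest [OF x(1) False jl(1)] rest [OF x(2) False jl(2)] RT jl Tdis [OF jl]
          Cdis [OF jl, of v1]
        by (auto split: if_splits)
    qed
  qed
qed

section \<open>Faces of the standard cube\<close>

definition corner :: "('n::finite \<Rightarrow> bool) \<Rightarrow> real ^ 'n" where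
  "corner x = (\<chi> i. if x i then 1 else -1)"

lemma corner_nth [simp]: "corner x $ i = (if x i then 1 else -1)"
  by (simp add: corner_def)

lemma corner_nth_eq: "corner x $ i = corner y $ i \<longleftrightarrow> x i = y i"
  by simp

lemma inj_corner: "corner x = corner y \<longleftrightarrow> x = y"
proof
  assume eq: "corner x = corner y"
  show "x = y"
  proof
    fix i
    have "corner x $ i = corner y $ i"
      using eq by simp
    then show "x i = y i"
      by (simp only: corner_nth_eq)
  qed
qed simp

lemma standard_cube_corners:
  "(standard_cube :: (real ^ 'n) set) = convex hull (range (corner :: ('n::finite \<Rightarrow> bool) \<Rightarrow> _))"
proof -
  have "x \<in> range corner" if "\<forall>i. x $ i = 1 \<or> x $ i = -1" for x :: "real ^ 'n"
  proof (rule range_eqI)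
    show "x = corner (\<lambda>i. x $ i = 1)"
      using that by (auto simp: vec_eq_iff)
  qed
  then have "{x :: real ^ 'n. \<forall>i. x $ i = 1 \<or> x $ i = -1} = range corner"
    by (auto split: if_splits)
  then show ?thesis
    by (simp add: standard_cube_def)
qed

lemma corner_in_standard_cube [simp]: "corner x \<in> standard_cube"
  unfolding standard_cube_corners by (rule hull_inc) simp

lemma standard_cube_bounds:
  fixes x :: "real ^ 'n::finite"
  assumes "x \<in> standard_cube"
  shows "-1 \<le> x $ i" "x $ i \<le> 1"
proof -
  have "standard_cube \<subseteq> cbox (\<chi> i. -1) (\<chi> i. 1)"
    unfolding standard_cube_corners
    by (rule hull_minimal) (auto simp: mem_box_cart)
  then have "x \<in> cbox (\<chi> i. -1) (\<chi> i. 1)"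
    using assms by blast
  then show "-1 \<le> x $ i" "x $ i \<le> 1"
    by (simp_all add: mem_box_cart)
qed

lemma convex_standard_cube: "convex standard_cube"
  by (simp add: standard_cube_corners)

lemma compact_standard_cube: "compact standard_cube"
proof -
  have "finite (range (corner :: ('n::finite \<Rightarrow> bool) \<Rightarrow> _))"
    by (rule finite_imageI) (rule finite)
  then show ?thesis
    unfolding standard_cube_corners by (rule finite_imp_compact_convex_hull)
qed

text \<open>One family covers all the faces needed: vertices (\<open>J = UNIV\<close>), edges
(\<open>J = - {k}\<close>) and facets (\<open>J = {j}\<close>).\<close>
definition cube_face :: "'n::finite set \<Rightarrow> ('n \<Rightarrow> bool) \<Rightarrow> (real ^ 'n) set" where
  "cube_face J x = {y \<in> standard_cube. \<forall>i\<in>J. y $ i = corner x $ i}"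

lemma corner_in_cube_face: "corner y \<in> cube_face J x \<longleftrightarrow> (\<forall>i\<in>J. y i = x i)"
  unfolding cube_face_def by (simp only: mem_Collect_eq corner_in_standard_cube corner_nth_eq simp_thms)

text \<open>The end points of the interval from \<open>-1\<close> to \<open>1\<close> are its extreme points; coordinate by
coordinate this makes \<open>cube_face J x\<close> a face.\<close>
lemma convex_combination_extreme:
  fixes a b u :: real
  assumes u: "0 < u" "u < 1" and a: "-1 \<le> a" "a \<le> 1" and b: "-1 \<le> b" "b \<le> 1"
    and s: "s = 1 \<or> s = -1" and eq: "(1 - u) * a + u * b = s"
  shows "a = s \<and> b = s"
proof -
  have *: "(1 - u) * (1 - a) \<ge> 0" "(1 - u) * (a + 1) \<ge> 0" "u * (1 - b) \<ge> 0" "u * (b + 1) \<ge> 0"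
    using assms by simp_all
  from s show ?thesis
  proof
    assume "s = 1"
    then have "(1 - u) * (1 - a) + u * (1 - b) = 0"
      using eq by (simp add: algebra_simps)
    then have "(1 - u) * (1 - a) = 0" "u * (1 - b) = 0"
      using * by linarith+
    then show ?thesis
      using u \<open>s = 1\<close> by simp
  next
    assume "s = -1"
    then have "(1 - u) * (a + 1) + u * (b + 1) = 0"
      using eq by (simp add: algebra_simps)
    then have "(1 - u) * (a + 1) = 0" "u * (b + 1) = 0"
      using * by linarith+
    then show ?thesis
      using u \<open>s = -1\<close> by simp
  qed
qed

lemma cube_face_face_of: "cube_face J x face_of standard_cube"
  unfolding face_of_def
proof (intro conjI ballI impI)
  show "cube_face J x \<subseteq> standard_cube"
    by (auto simp: cube_face_def)
  show "convex (cube_face J x)"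
  proof (rule convexI)
    fix y z and u w :: real
    assume yz: "y \<in> cube_face J x" "z \<in> cube_face J x" and uw: "0 \<le> u" "0 \<le> w" "u + w = 1"
    have "u *\<^sub>R y + w *\<^sub>R z \<in> standard_cube"
      using convex_standard_cube yz uw by (auto simp: cube_face_def intro: convexD)
    moreover have "u * s + w * s = s" for s
      using uw(3) by (metis distrib_right mult_1)
    ultimately show "u *\<^sub>R y + w *\<^sub>R z \<in> cube_face J x"
      using yz by (simp add: cube_face_def del: corner_nth)
  qed
next
  fix a b y
  assume ab: "a \<in> standard_cube" "b \<in> standard_cube" and y: "y \<in> cube_face J x"
    and seg: "y \<in> open_segment a b"
  obtain u where u: "0 < u" "u < 1" and yu: "y = (1 - u) *\<^sub>R a + u *\<^sub>R b"
    using seg by (auto simp: in_segment)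
  have "a $ i = corner x $ i \<and> b $ i = corner x $ i" if "i \<in> J" for i
  proof (rule convex_combination_extreme [OF u])
    show "(1 - u) * a $ i + u * b $ i = corner x $ i"
      using y that by (simp add: cube_face_def yu del: corner_nth)
  qed (use ab standard_cube_bounds in auto)
  then show "a \<in> cube_face J x" "b \<in> cube_face J x"
    using ab by (auto simp: cube_face_def simp del: corner_nth)
qed

lemma extreme_point_of_standard_cube: "c extreme_point_of standard_cube \<longleftrightarrow> (\<exists>x. c = corner x)"
proof
  assume "c extreme_point_of standard_cube"
  then have "c \<in> range corner"
    unfolding standard_cube_corners by (rule extreme_point_of_convex_hull)
  then show "\<exists>x. c = corner x"
    by blast
next
  assume "\<exists>x. c = corner x"
  then obtain x where x: "c = corner x"
    by blast
  have "cube_face UNIV x = {corner x}"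
    by (auto simp: cube_face_def vec_eq_iff simp del: corner_nth)
  then show "c extreme_point_of standard_cube"
    using cube_face_face_of [of UNIV x] by (simp add: x face_of_singleton)
qed

text \<open>The reason why the antipode of a vertex is not in its link: such a face contains the centre
\<open>0\<close>, which is the midpoint of every pair of antipodal corners, so it contains all corners.\<close>
lemma face_with_antipodal_corners:
  assumes F: "F face_of standard_cube" and a: "corner a \<in> F" "corner (\<lambda>j. \<not> a j) \<in> F"
  shows "F = standard_cube"
proof -
  have mid: "midpoint (corner y) (corner (\<lambda>j. \<not> y j)) = 0" for y :: "'a \<Rightarrow> bool"
    by (auto simp: midpoint_def vec_eq_iff)
  have convF: "convex F"
    using F by (rule face_of_imp_convex)
  then have "0 \<in> F"
    using closed_segment_subset [OF a convF] midpoint_in_closed_segment mid [of a] by (metis subsetD)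
  have "corner y \<in> F" for y
  proof -
    have "corner y \<noteq> corner (\<lambda>j. \<not> y j)"
      by (auto simp: inj_corner fun_eq_iff)
    then have "0 \<in> open_segment (corner y) (corner (\<lambda>j. \<not> y j))"
      using mid [of y] by (metis midpoint_in_open_segment)
    then show ?thesis
      using F \<open>0 \<in> F\<close> unfolding face_of_def by (meson corner_in_standard_cube)
  qed
  then have "standard_cube \<subseteq> F"
    unfolding standard_cube_corners using convF by (intro hull_minimal) auto
  then show ?thesis
    using F face_of_imp_subset by blast
qed

section \<open>The graph of the link\<close>

lemma face_iso_empty:
  assumes bij: "bij_betw f {F. F face_of P} {G. G face_of P'}"
    and mono: "\<And>F F'. F face_of P \<Longrightarrow> F' face_of P \<Longrightarrow> F \<subseteq> F' \<longleftrightarrow> f F \<subseteq> f F'"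
  shows "f {} = {}"
proof -
  have "{} \<in> f ` {F. F face_of P}"
    using bij by (simp add: bij_betw_def)
  then obtain F where "F face_of P" "f F = {}"
    by auto
  then show ?thesis
    using mono [of "{}" F] by simp
qed

text \<open>Extreme points are the atoms of the face lattice, because every nonempty face of a compact convex
set contains an extreme point; hence an isomorphism of face lattices preserves them.\<close>
lemma face_iso_extreme_point:
  fixes P' :: "'b::euclidean_space set"
  assumes P': "compact P'" "convex P'"
    and bij: "bij_betw f {F. F face_of P} {G. G face_of P'}"
    and mono: "\<And>F F'. F face_of P \<Longrightarrow> F' face_of P \<Longrightarrow> F \<subseteq> F' \<longleftrightarrow> f F \<subseteq> f F'"
    and x: "x extreme_point_of P"
  obtains c where "c extreme_point_of P'" "f {x} = {c}"
proof -
  have xP: "{x} face_of P"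
    using x by (simp add: face_of_singleton)
  have fx: "f {x} face_of P'"
    using bij xP by (auto simp: bij_betw_def)
  have "f {x} \<noteq> {}"
    using mono [of "{x}" "{}"] xP face_iso_empty [OF bij mono] by auto
  then obtain c where c: "c extreme_point_of f {x}"
    using extreme_point_exists_convex face_of_imp_compact [OF P'(2,1) fx] face_of_imp_convex [OF fx]
    by metis
  then have cP: "{c} face_of P'"
    using face_of_trans fx by (metis face_of_singleton)
  then have "{c} \<in> f ` {F. F face_of P}"
    using bij by (simp add: bij_betw_def)
  then obtain F where F: "F face_of P" "f F = {c}"
    by auto
  have "{c} \<subseteq> f {x}"
    using c by (auto simp: extreme_point_of_def)
  then have "F \<subseteq> {x}"
    using mono [OF F(1) xP] F(2) by simp
  moreover have "F \<noteq> {}"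
    using F(2) face_iso_empty [OF bij mono] by auto
  ultimately have "F = {x}"
    by blast
  then show ?thesis
    using F cP by (intro that [of c]) (auto simp: face_of_singleton)
qed

text \<open>The graph of the link of a vertex \<open>v\<close> of a combinatorial cube is the cube graph without
\<open>v\<close> and its antipode. Only the inclusion of the edges is stated, as linkedness is inherited from
spanning subgraphs. Two adjacent vertices that are different from \<open>v\<close> and its antipode share
with \<open>v\<close> a coordinate other than the one in which they differ, which puts their edge into a
facet through \<open>v\<close>. Facets are not defined by the order of the face lattice, but every proper
nonempty face of a polytope lies in one. That the preimage of a cube edge is one-dimensional
follows by the Krein-Milman theorem from its having exactly two extreme points.\<close>
lemma link_contains_punctured_cube:
  fixes Q :: "'a::euclidean_space set"
  assumes Q: "polytope Q"
    and eq: "combinatorially_equivalent Q (standard_cube :: (real ^ 'n::finite) set)"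
    and v: "v extreme_point_of Q"
  obtains p :: "('n::finite \<Rightarrow> bool) \<Rightarrow> 'a" and a where
    "inj p" "pverts (face_graph (polytope_link Q v)) = p ` (UNIV - {a, \<lambda>j. \<not> a j})"
    "\<And>x y. x \<notin> {a, \<lambda>j. \<not> a j} \<Longrightarrow> y \<notin> {a, \<lambda>j. \<not> a j} \<Longrightarrow> adj x y \<Longrightarrow>
       (p x, p y) \<in> parcs (face_graph (polytope_link Q v))"
proof -
  let ?cube = "standard_cube :: (real ^ 'n) set"
  have Qcc: "compact Q" "convex Q"
    using Q polytope_imp_compact polytope_imp_convex by auto
  obtain f where bij: "bij_betw f {F. F face_of Q} {G. G face_of ?cube}"
    and mono: "\<And>F F'. F face_of Q \<Longrightarrow> F' face_of Q \<Longrightarrow> F \<subseteq> F' \<longleftrightarrow> f F \<subseteq> f F'"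
    using eq unfolding combinatorially_equivalent_def by auto
  have f_face: "f F face_of ?cube" if "F face_of Q" for F
    using bij that by (auto simp: bij_betw_def)
  define g where "g = inv_into {F. F face_of Q} f"
  have bijg: "bij_betw g {G. G face_of ?cube} {F. F face_of Q}"
    unfolding g_def by (rule bij_betw_inv_into [OF bij])
  have g_face: "g G face_of Q" and fg: "f (g G) = G" if "G face_of ?cube" for G
    using bijg that bij_betw_inv_into_right [OF bij, of G] by (auto simp: bij_betw_def g_def)
  have gf: "g (f F) = F" if "F face_of Q" for F
    unfolding g_def using that bij_betw_inv_into_left [OF bij, of F] by simp
  have monog: "G \<subseteq> G' \<longleftrightarrow> g G \<subseteq> g G'" if "G face_of ?cube" "G' face_of ?cube" for G G'
    using mono [OF g_face g_face, OF that] fg that by simp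
  have "\<exists>q. q extreme_point_of Q \<and> g {corner x} = {q}" for x :: "'n \<Rightarrow> bool"
  proof -
    have "corner x extreme_point_of ?cube"
      using extreme_point_of_standard_cube by blast
    then show ?thesis
      using face_iso_extreme_point [OF Qcc bijg monog] by metis
  qed
  then obtain p where p: "\<And>x. p x extreme_point_of Q" "\<And>x. g {corner x} = {p x}"
    by metis
  have corner_face: "{corner x} face_of ?cube" for x
    using extreme_point_of_standard_cube face_of_singleton by blast
  have p_face: "{p x} face_of Q" for x
    using p(1) by (simp add: face_of_singleton)
  have fp: "f {p x} = {corner x}" for x
    using fg [OF corner_face] p(2) by metis
  have inj: "inj p"
    by (rule injI) (metis fp inj_corner singleton_inject)
  have onto: "\<exists>x. q = p x" if "q extreme_point_of Q" for q
  proof -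
    obtain c where "c extreme_point_of ?cube" "f {q} = {c}"
      using face_iso_extreme_point [OF compact_standard_cube convex_standard_cube bij mono \<open>q extreme_point_of Q\<close>]
      by blast
    then obtain x where "f {q} = {corner x}"
      using extreme_point_of_standard_cube by metis
    then have "{q} = {p x}"
      using gf [of "{q}"] p(2) that by (simp add: face_of_singleton)
    then show ?thesis
      by blast
  qed
  have mem: "p x \<in> F \<longleftrightarrow> corner x \<in> f F" if "F face_of Q" for x F
    using mono [OF p_face that, of x] fp by simp
  have mem_g: "p x \<in> g G \<longleftrightarrow> corner x \<in> G" if "G face_of ?cube" for x G
    using mem [OF g_face [OF that]] fg [OF that] by simp
  obtain a where a: "v = p a"
    using onto [OF v] by blast
  let ?bad = "{a, \<lambda>j. \<not> a j}"
  let ?L = "polytope_link Q v"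
  have in_link: "g G \<in> ?L" if G: "G face_of ?cube" "corner a \<notin> G" "G \<subseteq> cube_face {j} a" for G j
  proof -
    let ?F = "g (cube_face {j} a)"
    have F: "?F face_of Q"
      by (rule g_face [OF cube_face_face_of])
    have vF: "v \<in> ?F"
      unfolding a mem_g [OF cube_face_face_of] corner_in_cube_face by simp
    have "p (\<lambda>j. \<not> a j) \<notin> ?F"
      unfolding mem_g [OF cube_face_face_of] corner_in_cube_face by simp
    moreover have "p (\<lambda>j. \<not> a j) \<in> Q"
      using p(1) by (simp add: extreme_point_of_def)
    ultimately have "?F \<noteq> Q"
      by blast
    then obtain F' where F': "F' facet_of Q" "?F \<subseteq> F'"
      using face_of_polyhedron_subset_facet [OF polytope_imp_polyhedron [OF Q] F] vF by blast
    have "g G \<subseteq> ?F"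
      using monog [OF G(1) cube_face_face_of] G(3) by blast
    moreover have "v \<notin> g G"
      unfolding a mem_g [OF G(1)] by (rule G(2))
    ultimately show ?thesis
      unfolding polytope_link_def using F' vF g_face [OF G(1)] by blast
  qed
  have vertex_in_link: "{q} \<in> ?L \<longleftrightarrow> q \<in> p ` (UNIV - ?bad)" for q
  proof
    assume L: "{q} \<in> ?L"
    then obtain F' where q: "{q} face_of Q" "v \<noteq> q" and F': "F' facet_of Q" "v \<in> F'" "q \<in> F'"
      unfolding polytope_link_def by blast
    obtain x where x: "q = p x"
      using onto q(1) face_of_singleton by blast
    have "x \<noteq> (\<lambda>j. \<not> a j)"
    proof
      assume "x = (\<lambda>j. \<not> a j)"
      have face: "F' face_of Q"
        using F'(1) by (rule facet_of_imp_face_of)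
      have "f F' = ?cube"
        using face_with_antipodal_corners [OF f_face [OF face]] mem [OF face] F'(2,3)
          \<open>x = (\<lambda>j. \<not> a j)\<close> a x by blast
      then have "f Q \<subseteq> f F'"
        using f_face [OF face_of_refl [OF Qcc(2)]] face_of_imp_subset by blast
      then have "Q \<subseteq> F'"
        using mono [OF face_of_refl [OF Qcc(2)] face] by blast
      then have "F' = Q"
        using facet_of_imp_subset F'(1) by blast
      then show False
        using F'(1) by simp
    qed
    moreover have "x \<noteq> a"
      using q(2) a x by blast
    ultimately show "q \<in> p ` (UNIV - ?bad)"
      using x by blast
  next
    assume "q \<in> p ` (UNIV - ?bad)"
    then obtain x where x: "q = p x" "x \<noteq> a" "x \<noteq> (\<lambda>j. \<not> a j)"
      by blast
    then obtain j where j: "x j = a j"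
      by (auto simp: fun_eq_iff)
    have "{corner x} \<subseteq> cube_face {j} a"
      using j by (simp add: corner_in_cube_face)
    moreover have "corner a \<notin> {corner x}"
      using x(2) by (simp add: inj_corner)
    ultimately have "g {corner x} \<in> ?L"
      by (intro in_link [OF corner_face])
    then show "{q} \<in> ?L"
      using p(2) x(1) by simp
  qed
  have arcs: "(p x, p y) \<in> parcs (face_graph ?L)"
    if x: "x \<notin> ?bad" and y: "y \<notin> ?bad" and xy: "adj x y" for x y
  proof -
    obtain k where k: "y = flip k x"
      using xy by (auto simp: adj_def)
    obtain j where j: "j \<noteq> k" "x j = a j"
    proof (rule ccontr)
      assume "\<not> thesis"
      then have all: "x j = (\<not> a j)" if "j \<noteq> k" for j
        using that \<open>\<And>j. j \<noteq> k \<Longrightarrow> x j = a j \<Longrightarrow> thesis\<close> by blast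
      show False
      proof (cases "x k = a k")
        case True
        have "y = (\<lambda>j. \<not> a j)"
        proof
          show "y j = (\<not> a j)" for j
            by (cases "j = k") (simp_all add: k all True)
        qed
        then show False
          using y by simp
      next
        case False
        have "x = (\<lambda>j. \<not> a j)"
        proof
          show "x j = (\<not> a j)" for j
            by (cases "j = k") (use all False in simp_all)
        qed
        then show False
          using x by simp
      qed
    qed
    define G where "G = cube_face (- {k}) x"
    have G: "G face_of ?cube"
      unfolding G_def by (rule cube_face_face_of)
    have corners: "corner z \<in> G \<longleftrightarrow> z = x \<or> z = y" for z
    proof
      assume "corner z \<in> G"
      then have z: "z i = x i" if "i \<noteq> k" for i
        using that by (auto simp: G_def corner_in_cube_face)
      have "z = (if z k = x k then x else y)"
      proof
        show "z i = (if z k = x k then x else y) i" for i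
          by (cases "i = k") (simp_all add: k z)
      qed
      then show "z = x \<or> z = y"
        by (simp split: if_splits)
    qed (auto simp: G_def corner_in_cube_face k)
    have "corner a \<notin> G"
      using corners x y by auto
    moreover have "G \<subseteq> cube_face {j} a"
      using j by (auto simp: G_def cube_face_def)
    ultimately have L: "g G \<in> ?L"
      by (intro in_link [OF G])
    have ext: "q extreme_point_of g G \<longleftrightarrow> q = p x \<or> q = p y" for q
    proof -
      have "q extreme_point_of g G \<longleftrightarrow> (\<exists>z. q = p z \<and> corner z \<in> G)"
        using extreme_point_of_face [OF g_face [OF G]] onto p(1) mem_g [OF G] by metis
      then show ?thesis
        using corners by auto
    qed
    then have "{q. q extreme_point_of g G} = {p x, p y}"
      by auto
    then have "g G = convex hull {p x, p y}"
      using Krein_Milman_Minkowski [of "g G"] face_of_imp_compact [OF Qcc(2,1) g_face [OF G]]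
        face_of_imp_convex [OF g_face [OF G]] by simp
    moreover have "p x \<noteq> p y"
      using inj xy by (metis adj_irrefl injD)
    ultimately have "aff_dim (g G) = 1"
      by (simp add: aff_dim_convex_hull)
    then show ?thesis
      unfolding face_graph_def using L ext \<open>p x \<noteq> p y\<close> by auto
  qed
  show ?thesis
  proof (rule that [OF inj])
    show "pverts (face_graph ?L) = p ` (UNIV - ?bad)"
      unfolding face_graph_def using vertex_in_link by auto
  qed (rule arcs)
qed

lemma conn_imp_vpath:
  assumes p: "\<And>x. x \<in> A \<Longrightarrow> p x \<in> verts G"
    and arcs: "\<And>x y. x \<in> A \<Longrightarrow> y \<in> A \<Longrightarrow> adj x y \<Longrightarrow> (p x, p y) \<in> arcs_ends G"
    and A: "conn A" "x \<in> A" "y \<in> A"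
  obtains L where "vpath L G" "hd L = p x" "last L = p y" "set L \<subseteq> p ` A"
proof -
  have "(\<lambda>u v. u \<in> A \<and> v \<in> A \<and> adj u v)\<^sup>*\<^sup>* x y"
    using A by (auto simp: conn_def)
  then have "\<exists>L. vwalk L G \<and> hd L = p x \<and> last L = p y \<and> set L \<subseteq> p ` A"
  proof (induction rule: converse_rtranclp_induct)
    case base
    then show ?case
      using A(3) p by (intro exI [of _ "[p y]"]) auto
  next
    case (step u w)
    then obtain L where L: "vwalk L G" "hd L = p w" "last L = p y" "set L \<subseteq> p ` A"
      by blast
    then have "L \<noteq> []"
      by (auto simp: vwalk_def)
    moreover have "vwalk (p u # L) G"
      using L step p arcs by (intro vwalk_consI) auto
    ultimately show ?case
      using L step by (intro exI [of _ "p u # L"]) auto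
  qed
  then obtain L where L: "vwalk L G" "hd L = p x" "last L = p y" "set L \<subseteq> p ` A"
    by blast
  show ?thesis
  proof (rule that)
    show "vpath (vwalk_to_vpath L) G"
      using L(1) by (rule vwalk_to_vpath_vpath)
    show "set (vwalk_to_vpath L) \<subseteq> p ` A"
      by (rule subset_trans [OF _ L(4)]) (rule subsetI, rule vwalk_to_vpath_subset)
  qed (use L in \<open>simp_all add: vwalk_to_vpath_hd vwalk_to_vpath_last\<close>)
qed

section \<open>Linkedness of the link\<close>

theorem proposition27:
  fixes d :: nat and Q :: "'a::euclidean_space set" and v :: 'a
  assumes "2 \<le> d" and "d \<noteq> 3"
    and "CARD('n::finite) = d + 1"
    and "polytope Q"
    and "combinatorially_equivalent Q (standard_cube :: (real ^ 'n) set)"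
    and "v extreme_point_of Q"
  shows "k_linked ((d + 1) div 2) (with_proj (face_graph (polytope_link Q v)))"
proof -
  let ?k = "(d + 1) div 2" and ?G = "face_graph (polytope_link Q v)"
  obtain p :: "('n \<Rightarrow> bool) \<Rightarrow> 'a" and a where inj: "inj p"
    and verts: "pverts ?G = p ` (UNIV - {a, \<lambda>j. \<not> a j})"
    and arcs: "\<And>x y. x \<notin> {a, \<lambda>j. \<not> a j} \<Longrightarrow> y \<notin> {a, \<lambda>j. \<not> a j} \<Longrightarrow> adj x y \<Longrightarrow>
       (p x, p y) \<in> parcs ?G"
    using link_contains_punctured_cube [OF assms(4-6)] by metis
  let ?W = "UNIV - {a, \<lambda>j. \<not> a j}"
  have fin: "finite Z" for Z :: "('n \<Rightarrow> bool) set"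
    by (rule finite)
  have "card (UNIV :: ('n \<Rightarrow> bool) set) = 2 ^ (d + 1)"
    using card_subcube [of "UNIV :: 'n set"] assms(3) by simp
  then have "card (pverts ?G) = 2 ^ (d + 1) - card {a, \<lambda>j. \<not> a j}"
    unfolding verts using inj by (subst card_image) (auto intro: inj_on_subset simp: card_Diff_subset)
  moreover have "card {a, \<lambda>j. \<not> a j} \<le> 2"
    by (simp add: card_insert_if)
  moreover have "d + 1 + 2 \<le> (2::nat) ^ (d + 1)"
    using assms(1)
  proof (induction d rule: dec_induct)
    case (step n)
    then show ?case
      by simp
  qed simp
  ultimately have card: "2 * ?k \<le> card (pverts ?G)"
    by linarith
  have link: "linkable ?W {..<?k} T"
    if T: "pairing ?W {..<?k} T" for T :: "nat \<Rightarrow> ('n \<Rightarrow> bool) set"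
  proof (cases "d = 2")
    case True
    \<comment> \<open>The link graph of the 3-cube is a hexagon, and there is one pair to be linked.\<close>
    have "card {a, \<lambda>j. \<not> a j} < CARD('n)"
      using \<open>card {a, \<lambda>j. \<not> a j} \<le> 2\<close> True assms(3) by simp
    then have "conn (subcube UNIV a - {a, \<lambda>j. \<not> a j})"
      by (intro conn_subcube_diff) auto
    then show ?thesis
      using True pairingD(1) [OF T] by (intro linkableI [where C = "\<lambda>_. ?W"]) auto
  next
    case False
    show ?thesis
    proof (rule linkable_minus_antipodes [OF _ T])
      show "5 \<le> CARD('n)"
        using assms False by simp
      have "card (\<Union>j<?k. T j) \<le> (\<Sum>j<?k. card (T j))"
        by (rule card_UN_le) simp
      also have "\<dots> \<le> (\<Sum>j<?k. 2)"
        using pairingD(2) [OF T] by (intro sum_mono) auto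
      also have "\<dots> \<le> CARD('n)"
        using assms(3) by simp
      finally show "card (\<Union>j<?k. T j) \<le> CARD('n)" .
    qed
  qed
  show ?thesis
    unfolding k_linked_def with_proj_simps
  proof (intro conjI allI impI card)
    fix s t :: "nat \<Rightarrow> 'a"
    assume s: "s ` {..<?k} \<subseteq> pverts ?G" and t: "t ` {..<?k} \<subseteq> pverts ?G"
      and inj_s: "inj_on s {..<?k}" and inj_t: "inj_on t {..<?k}"
      and st: "s ` {..<?k} \<inter> t ` {..<?k} = {}"
    have "\<exists>x. s j = p x \<and> x \<in> ?W" "\<exists>x. t j = p x \<and> x \<in> ?W" if "j < ?k" for j
      using s t that unfolding verts by blast+
    then obtain s' t' where s': "\<And>j. j < ?k \<Longrightarrow> s j = p (s' j) \<and> s' j \<in> ?W"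
        and t': "\<And>j. j < ?k \<Longrightarrow> t j = p (t' j) \<and> t' j \<in> ?W"
      by metis
    define T where "T j = {s' j, t' j}" for j
    have "pairing ?W {..<?k} T"
    proof (rule pairingI)
      fix j assume "j \<in> {..<?k}"
      then show "T j \<subseteq> ?W"
        using s' t' by (simp add: T_def)
      show "card (T j) \<le> 2"
        by (simp add: T_def card_insert_if)
    next
      fix j l x assume jl: "j \<in> {..<?k}" "l \<in> {..<?k}" and x: "x \<in> T j" "x \<in> T l"
      have "s j \<noteq> t l" "s l \<noteq> t j"
        using st jl by blast+
      moreover have "p x = s j \<or> p x = t j" "p x = s l \<or> p x = t l"
        using x jl s' t' by (auto simp: T_def)
      ultimately have "s j = s l \<or> t j = t l"
        by metis
      then show "j = l"
        using inj_s inj_t jl by (auto dest: inj_onD)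
    qed
    then have "linkable ?W {..<?k} T"
      by (rule link)
    then obtain C where C: "\<forall>j\<in>{..<?k}. T j \<subseteq> C j \<and> C j \<subseteq> ?W \<and> conn (C j)"
      and Cdis: "\<forall>j\<in>{..<?k}. \<forall>l\<in>{..<?k}. \<forall>x. x \<in> C j \<longrightarrow> x \<in> C l \<longrightarrow> j = l"
      by (rule linkableE)
    have "\<exists>L. vpath L (with_proj ?G) \<and> hd L = s j \<and> last L = t j \<and> set L \<subseteq> p ` C j"
      if j: "j < ?k" for j
    proof -
      have Cj: "s' j \<in> C j" "t' j \<in> C j" "C j \<subseteq> ?W" "conn (C j)"
        using C j by (auto simp: T_def)
      obtain L where "vpath L (with_proj ?G)" "hd L = p (s' j)" "last L = p (t' j)" "set L \<subseteq> p ` C j"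
      proof (rule conn_imp_vpath [OF _ _ Cj(4,1,2)])
        show "p x \<in> verts (with_proj ?G)" if "x \<in> C j" for x
          using that Cj(3) by (auto simp: verts)
        show "(p x, p y) \<in> arcs_ends (with_proj ?G)" if "x \<in> C j" "y \<in> C j" "adj x y" for x y
          using that Cj(3) by (auto intro!: arcs)
      qed
      then show ?thesis
        using s' [OF j] t' [OF j] by auto
    qed
    then obtain L where L: "\<And>j. j < ?k \<Longrightarrow>
        vpath (L j) (with_proj ?G) \<and> hd (L j) = s j \<and> last (L j) = t j \<and> set (L j) \<subseteq> p ` C j"
      by metis
    have "disjoint_family_on (\<lambda>i. set (L i)) {..<?k}"
      unfolding disjoint_family_on_def
    proof (intro ballI impI)
      fix i j assume ij: "i \<in> {..<?k}" "j \<in> {..<?k}" "i \<noteq> j"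
      then have "C i \<inter> C j = {}"
        using Cdis by blast
      then have "p ` C i \<inter> p ` C j = {}"
        using inj by (metis image_Int image_empty)
      then show "set (L i) \<inter> set (L j) = {}"
        using L [of i] L [of j] ij by auto
    qed
    then show "\<exists>L. (\<forall>i<?k. vpath (L i) (with_proj ?G) \<and> hd (L i) = s i \<and> last (L i) = t i) \<and>
        disjoint_family_on (\<lambda>i. set (L i)) {..<?k}"
      using L by blast
  qed
qed

end
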